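(* Let $\mathcal G$ be a finite connected groupoid, $x\in\mathcal G_0$, $\tau(x)=\{\tau_y\}_{y\in\mathcal G_0}$ a transversal for $x$, $A$ a ring, and $\beta=(B_g,\beta_g)_{g\in\mathcal G}$ the lifted partial action of $\mathcal G$ on $A$ coming from a datum $(I,\gamma_{\tau(x)},\gamma_{(x)})\in\mathcal D_{\tau(x)}(A)$. Assume that $\beta$ is $\tau(x)$-global and $\gamma$-unital, and that $A=\bigoplus_{y\in\mathcal G_0}I_y=\bigoplus_{y\in\mathcal G_0}B_y$. Then the ring extensions $A\subset A\star_\beta\mathcal G$ and $B_x\subset B_x\star_{\beta_{(x)}}\mathcal G(x)$ are Frobenius.
   Context: Conventions. Rings are associative, not necessarily unital; ideals are two-sided. A groupoid $\mathcal G$ is a small category in which every morphism is invertible; it is identified with its set of morphisms, and its set of objects $\mathcal G_0$ is identified with the set of identity morphisms. For $g\in\mathcal G$, $s(g)=g^{-1}g$ and $t(g)=gg^{-1}$; $gh$ is defined iff $s(g)=t(h)$. Put $\mathcal G(y,z)=\{g: s(g)=y,\ t(g)=z\}$ and $\mathcal G(x)=\mathcal G(x,x)$ (a group). $\mathcal G$ is connected if $\mathcal G(y,z)\neq\emptyset$ for all $y,z\in\mathcal G_0$. A transversal for $x$ is a family $\tau(x)=\{\tau_y: y\in\mathcal G_0\}$ with $\tau_y\in\mathcal G(x,y)$ and $\tau_x=x$. Put $g_x=\tau_{t(g)}^{-1}g\tau_{s(g)}\in\mathcal G(x)$. For partial bijections, $u\circ v$ has domain $v^{-1}(\mathrm{dom}(u)\cap\mathrm{ran}(v))$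 and range $u(\mathrm{dom}(u)\cap\mathrm{ran}(v))$. A partial action of a groupoid $\mathcal G$ on a ring $A$ is a family $\alpha=(A_g,\alpha_g)_{g\in\mathcal G}$ where, for each $g$, $A_{t(g)}$ is an ideal of $A$, $A_g$ is an ideal of $A_{t(g)}$, $\alpha_g:A_{g^{-1}}\to A_g$ is a ring isomorphism, $\alpha_y=\mathrm{id}_{A_y}$ for $y\in\mathcal G_0$, and $\alpha_{gh}$ extends $\alpha_g\circ\alpha_h$ whenever $s(g)=t(h)$. A partial action of a group $H$ on a ring $R$ is the one-object case with the ideal attached to the identity equal to $R$; it is unital if each of its ideals is a unital ring whose identity is a central idempotent of $R$. The partial action $\alpha$ is $\tau(x)$-global if $A_{\tau_y^{-1}}=A_x$ and $A_{\tau_y}=A_y$ for all $y\in\mathcal G_0$. An object of $\mathcal D_{\tau(x)}(A)$ is a datum $(I,\gamma_{\tau(x)},\gamma_{(x)})$ consisting of: (a) a family $I=\{I_y\}_{y\in\mathcal G_0}$ of ideals of $A$; (b) ring isomorphisms $\gamma_{\tau(x)}=\{\gamma_{\tau_y}:I_{\tau_y^{-1}}\to I_{\tau_y}\}_{y\in\mathcal G_0}$; (c) a partial action $\gamma_{(x)}=(I_h,\gamma_h)_{h\in\mathcal G(x)}$ of the group $\mathcal G(x)$ on $I_x$; such that (d) $\gamma_x=\gamma_{\tau_x}$ is the identity map of $I_x=I_{\tau_x}$; (e) $I_{\tau_y}$ is an ideal of $I_y$ and $I_{\tau_y^{-1}}$ is an ideal of $I_x$ for all $y$; (f) $\gamma_{\tau_{t(g)}}\big(I_{\tau_{t(g)}^{-1}}\cap\gamma_{g_x}(I_{\tau_{s(g)}^{-1}}\cap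 I_{g_x^{-1}})\big)$ is an ideal of $I_{t(g)}$ for all $g\in\mathcal G$. The lifted partial action coming from it is $\beta=(B_g,\beta_g)_{g\in\mathcal G}$ with $\beta_y=\mathrm{id}_{I_y}$ for $y\in\mathcal G_0$, $\beta_g=\gamma_{\tau_{t(g)}}\circ\gamma_{g_x}\circ\gamma_{\tau_{s(g)}}^{-1}$ for $g\notin\mathcal G_0$ (composition of partial bijections), and $B_g$ the range of $\beta_g$; it is a partial action of $\mathcal G$ on $A$. It is called $\gamma$-unital if $I_x$ is a unital ring and $\gamma_{(x)}$ is a unital partial group action. When $\beta$ is $\tau(x)$-global and $\gamma$-unital, $B_g=\gamma_{\tau_{t(g)}}(I_{g_x})=A1_g$ for all $g\in\mathcal G$, where $1_h$ is the identity of $I_h$ for $h\in\mathcal G(x)$ and $1_g=\gamma_{\tau_{t(g)}}(1_{g_x})$ is the identity of $B_g$, a central idempotent of $A$. The restriction $\beta_{(x)}=(B_h,\beta_h)_{h\in\mathcal G(x)}$ is a partial action of $\mathcal G(x)$ on $B_x$; it equals $\gamma_{(x)}$. The partial skew groupoid ring is $A\star_\beta\mathcal G=\bigoplus_{g\in\mathcal G}B_g\delta_g$ ($\delta_g$ placeholder symbols), with multiplication determined by $(a\delta_g)(b\delta_h)=a\beta_g(b1_{g^{-1}})\delta_{gh}$ if $s(g)=t(h)$ and $0$ otherwise ($a\in B_g$, $b\in B_h$); its identity is $\sum_{y\in\mathcal G_0}1_y\delta_y$. It is an extension of $A$ via $a\mapsto\sum_{y\in\mathcal G_0}(a1_y)\delta_y$.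 Similarly $B_x\star_{\beta_{(x)}}\mathcal G(x)=\bigoplus_{h\in\mathcal G(x)}B_h\delta_h$ is an extension of $B_x$ via $b\mapsto b\delta_x$. A unital ring extension $R\subset S$ is Frobenius if there exist an element $u=\sum_{i=1}^ns_{i1}\otimes s_{i2}\in S\otimes_RS$ and an $R$-bimodule map $\varepsilon:S\to R$ such that $su=us$ for all $s\in S$ and $\sum_{i=1}^n\varepsilon(s_{i1})s_{i2}=\sum_{i=1}^ns_{i1}\varepsilon(s_{i2})=1$. *)

theory Defs
  imports "HOL-Algebra.RingHom" "HOL-Algebra.Free_Abelian_Groups"
begin

section \<open>Groupoids\<close>

text \<open>Arrows-only presentation: the objects are identified with the identity morphisms, and
  \<open>g \<odot> h\<close> is meaningful only when \<open>src g = tgt h\<close>.\<close>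

record 'g arrow_structure = "'g partial_object" +
  cmp :: "'g \<Rightarrow> 'g \<Rightarrow> 'g"  (infixl \<open>\<odot>\<index>\<close> 70)
  src :: "'g \<Rightarrow> 'g"
  tgt :: "'g \<Rightarrow> 'g"

definition is_inverse :: "('g, 'm) arrow_structure_scheme \<Rightarrow> 'g \<Rightarrow> 'g \<Rightarrow> bool" where
  "is_inverse G g h \<longleftrightarrow> h \<in> carrier G \<and> src G h = tgt G g \<and> tgt G h = src G g \<and>
     h \<odot>\<^bsub>G\<^esub> g = src G g \<and> g \<odot>\<^bsub>G\<^esub> h = tgt G g"

definition ginv :: "('g, 'm) arrow_structure_scheme \<Rightarrow> 'g \<Rightarrow> 'g" where
  "ginv G g = (THE h. is_inverse G g h)"

locale groupoid =
  fixes G :: "('g, 'm) arrow_structure_scheme" (structure)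
  assumes src_closed: "g \<in> carrier G \<Longrightarrow> src G g \<in> carrier G"
    and tgt_closed: "g \<in> carrier G \<Longrightarrow> tgt G g \<in> carrier G"
    and src_src: "g \<in> carrier G \<Longrightarrow> src G (src G g) = src G g"
    and tgt_src: "g \<in> carrier G \<Longrightarrow> tgt G (src G g) = src G g"
    and src_tgt: "g \<in> carrier G \<Longrightarrow> src G (tgt G g) = tgt G g"
    and tgt_tgt: "g \<in> carrier G \<Longrightarrow> tgt G (tgt G g) = tgt G g"
    and cmp_closed: "\<lbrakk>g \<in> carrier G; h \<in> carrier G; src G g = tgt G h\<rbrakk> \<Longrightarrow> g \<odot> h \<in> carrier G"
    and src_cmp: "\<lbrakk>g \<in> carrier G; h \<in> carrier G; src G g = tgt G h\<rbrakk> \<Longrightarrow> src G (g \<odot> h) = src G h"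
    and tgt_cmp: "\<lbrakk>g \<in> carrier G; h \<in> carrier G; src G g = tgt G h\<rbrakk> \<Longrightarrow> tgt G (g \<odot> h) = tgt G g"
    and cmp_assoc: "\<lbrakk>g \<in> carrier G; h \<in> carrier G; k \<in> carrier G;
        src G g = tgt G h; src G h = tgt G k\<rbrakk> \<Longrightarrow> (g \<odot> h) \<odot> k = g \<odot> (h \<odot> k)"
    and cmp_src: "g \<in> carrier G \<Longrightarrow> g \<odot> src G g = g"
    and tgt_cmp_self: "g \<in> carrier G \<Longrightarrow> tgt G g \<odot> g = g"
    and ex_inverse: "g \<in> carrier G \<Longrightarrow> \<exists>h. is_inverse G g h"

definition objects :: "('g, 'm) arrow_structure_scheme \<Rightarrow> 'g set" where
  "objects G = src G ` carrier G"

definition arrows :: "('g, 'm) arrow_structure_scheme \<Rightarrow> 'g \<Rightarrow> 'g \<Rightarrow> 'g set" where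
  "arrows G y z = {g \<in> carrier G. src G g = y \<and> tgt G g = z}"

definition connected_groupoid :: "('g, 'm) arrow_structure_scheme \<Rightarrow> bool" where
  "connected_groupoid G \<longleftrightarrow> (\<forall>y\<in>objects G. \<forall>z\<in>objects G. arrows G y z \<noteq> {})"

text \<open>The isotropy group at \<open>x\<close>, kept as a groupoid whose only object is \<open>x\<close>.\<close>

definition isotropy :: "('g, 'm) arrow_structure_scheme \<Rightarrow> 'g \<Rightarrow> ('g, 'm) arrow_structure_scheme" where
  "isotropy G x = G\<lparr>carrier := arrows G x x\<rparr>"

definition transversal :: "('g, 'm) arrow_structure_scheme \<Rightarrow> 'g \<Rightarrow> ('g \<Rightarrow> 'g) \<Rightarrow> bool" where
  "transversal G x \<tau> \<longleftrightarrow> (\<forall>y\<in>objects G. \<tau> y \<in> arrows G x y) \<and> \<tau> x = x"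

definition loop_of :: "('g, 'm) arrow_structure_scheme \<Rightarrow> ('g \<Rightarrow> 'g) \<Rightarrow> 'g \<Rightarrow> 'g" where
  "loop_of G \<tau> g = (ginv G (\<tau> (tgt G g)) \<odot>\<^bsub>G\<^esub> g) \<odot>\<^bsub>G\<^esub> \<tau> (src G g)"


section \<open>Rings that need not have an identity\<close>

text \<open>Such rings are carried by the usual ring records, with the field \<open>one\<close> ignored: the
  library locales \<open>ring\<close>, \<open>ideal\<close> and the sets \<open>ring_hom\<close>, \<open>ring_iso\<close> all presuppose an
  identity. An ideal \<open>J\<close> of \<open>R\<close> is regarded as the ring \<open>R\<lparr>carrier := J\<rparr>\<close>.\<close>

locale rng = abelian_group R for R :: "('a, 'm) ring_scheme" (structure) +
  assumes rng_closed: "\<lbrakk>a \<in> carrier R; b \<in> carrier R\<rbrakk> \<Longrightarrow> a \<otimes> b \<in> carrier R"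
    and rng_assoc: "\<lbrakk>a \<in> carrier R; b \<in> carrier R; c \<in> carrier R\<rbrakk>
      \<Longrightarrow> (a \<otimes> b) \<otimes> c = a \<otimes> (b \<otimes> c)"
    and rng_l_distr: "\<lbrakk>a \<in> carrier R; b \<in> carrier R; c \<in> carrier R\<rbrakk>
      \<Longrightarrow> (a \<oplus> b) \<otimes> c = a \<otimes> c \<oplus> b \<otimes> c"
    and rng_r_distr: "\<lbrakk>a \<in> carrier R; b \<in> carrier R; c \<in> carrier R\<rbrakk>
      \<Longrightarrow> c \<otimes> (a \<oplus> b) = c \<otimes> a \<oplus> c \<otimes> b"

definition rng_ideal :: "'a set \<Rightarrow> ('a, 'm) ring_scheme \<Rightarrow> bool" where
  "rng_ideal J R \<longleftrightarrow> additive_subgroup J R \<and>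
     (\<forall>a\<in>J. \<forall>r\<in>carrier R. r \<otimes>\<^bsub>R\<^esub> a \<in> J \<and> a \<otimes>\<^bsub>R\<^esub> r \<in> J)"

definition is_identity :: "('a, 'm) ring_scheme \<Rightarrow> 'a \<Rightarrow> bool" where
  "is_identity R e \<longleftrightarrow> e \<in> carrier R \<and> (\<forall>a\<in>carrier R. e \<otimes>\<^bsub>R\<^esub> a = a \<and> a \<otimes>\<^bsub>R\<^esub> e = a)"

definition unital_rng :: "('a, 'm) ring_scheme \<Rightarrow> bool" where
  "unital_rng R \<longleftrightarrow> (\<exists>e. is_identity R e)"

definition identity_of :: "('a, 'm) ring_scheme \<Rightarrow> 'a" where
  "identity_of R = (THE e. is_identity R e)"

text \<open>Sets the ignored field \<open>one\<close> to the actual identity, so that the library locale \<open>ring\<close>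
  applies; without an identity the result is not a \<open>ring\<close>.\<close>

definition with_one :: "('a, 'm) ring_scheme \<Rightarrow> ('a, 'm) ring_scheme" where
  "with_one R = R\<lparr>one := identity_of R\<rparr>"

definition central_idempotent :: "('a, 'm) ring_scheme \<Rightarrow> 'a \<Rightarrow> bool" where
  "central_idempotent R e \<longleftrightarrow> e \<in> carrier R \<and> e \<otimes>\<^bsub>R\<^esub> e = e \<and>
     (\<forall>a\<in>carrier R. e \<otimes>\<^bsub>R\<^esub> a = a \<otimes>\<^bsub>R\<^esub> e)"

text \<open>Internal direct sum over a finite index set \<open>T\<close>; \<open>finsum\<close> is zero on infinite sets.\<close>

definition internal_direct_sum :: "('a, 'm) ring_scheme \<Rightarrow> 'i set \<Rightarrow> ('i \<Rightarrow> 'a set) \<Rightarrow> bool" where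
  "internal_direct_sum R T J \<longleftrightarrow> (\<forall>i\<in>T. rng_ideal (J i) R) \<and>
     (\<forall>a\<in>carrier R. \<exists>!c. c \<in> PiE T J \<and> a = finsum R c T)"


section \<open>Partial actions\<close>

text \<open>Partial bijections are partial functions \<open>'a \<rightharpoonup> 'a\<close>. The domain and range of \<open>u \<circ>\<^sub>m v\<close> are
  those prescribed for the composition of partial bijections, and \<open>Some |` J\<close> is the identity
  map of \<open>J\<close>.\<close>

definition partial_inverse :: "('a \<rightharpoonup> 'a) \<Rightarrow> ('a \<rightharpoonup> 'a)" where
  "partial_inverse u = (\<lambda>b. if b \<in> ran u then Some (THE a. u a = Some b) else None)"

definition rng_iso :: "('a, 'm) ring_scheme \<Rightarrow> 'a set \<Rightarrow> 'a set \<Rightarrow> ('a \<rightharpoonup> 'a) \<Rightarrow> bool" where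
  "rng_iso R P Q u \<longleftrightarrow> dom u = P \<and>
     (\<lambda>a. the (u a)) \<in> iso (R\<lparr>carrier := P\<rparr>) (R\<lparr>carrier := Q\<rparr>) \<and>
     (\<lambda>a. the (u a)) \<in> iso (add_monoid (R\<lparr>carrier := P\<rparr>)) (add_monoid (R\<lparr>carrier := Q\<rparr>))"

definition partial_action ::
    "('g, 'm) arrow_structure_scheme \<Rightarrow> ('a, 'n) ring_scheme \<Rightarrow> ('g \<Rightarrow> 'a set) \<Rightarrow> ('g \<Rightarrow> 'a \<rightharpoonup> 'a) \<Rightarrow> bool"
  where
  "partial_action G A D \<alpha> \<longleftrightarrow>
     (\<forall>g\<in>carrier G. rng_ideal (D (tgt G g)) A \<and>
        rng_ideal (D g) (A\<lparr>carrier := D (tgt G g)\<rparr>) \<and>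
        rng_iso A (D (ginv G g)) (D g) (\<alpha> g)) \<and>
     (\<forall>y\<in>objects G. \<alpha> y = Some |` D y) \<and>
     (\<forall>g\<in>carrier G. \<forall>h\<in>carrier G. src G g = tgt G h \<longrightarrow> (\<alpha> g \<circ>\<^sub>m \<alpha> h) \<subseteq>\<^sub>m \<alpha> (g \<odot>\<^bsub>G\<^esub> h))"

text \<open>In the next two definitions \<open>H\<close> is a group, that is, a groupoid with one object.\<close>

definition group_partial_action ::
    "('g, 'm) arrow_structure_scheme \<Rightarrow> ('a, 'n) ring_scheme \<Rightarrow> ('g \<Rightarrow> 'a set) \<Rightarrow> ('g \<Rightarrow> 'a \<rightharpoonup> 'a) \<Rightarrow> bool"
  where
  "group_partial_action H R D \<alpha> \<longleftrightarrow>
     partial_action H R D \<alpha> \<and> (\<forall>e\<in>objects H. D e = carrier R)"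

definition unital_group_partial_action ::
    "('g, 'm) arrow_structure_scheme \<Rightarrow> ('a, 'n) ring_scheme \<Rightarrow> ('g \<Rightarrow> 'a set) \<Rightarrow> ('g \<Rightarrow> 'a \<rightharpoonup> 'a) \<Rightarrow> bool"
  where
  "unital_group_partial_action H R D \<alpha> \<longleftrightarrow> group_partial_action H R D \<alpha> \<and>
     (\<forall>h\<in>carrier H. \<exists>e. is_identity (R\<lparr>carrier := D h\<rparr>) e \<and> central_idempotent R e)"

definition global_along ::
    "('g, 'm) arrow_structure_scheme \<Rightarrow> 'g \<Rightarrow> ('g \<Rightarrow> 'g) \<Rightarrow> ('g \<Rightarrow> 'a set) \<Rightarrow> bool" where
  "global_along G x \<tau> D \<longleftrightarrow>
     (\<forall>y\<in>objects G. D (ginv G (\<tau> y)) = D x \<and> D (\<tau> y) = D y)"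

text \<open>Objects of the category \<open>\<D>\<^bsub>\<tau>(x)\<^esub>(A)\<close>. As in the notation of the mathematical datum, all
  the ideals \<open>I\<^sub>y\<close>, \<open>I\<^sub>h\<close>, \<open>I\<^bsub>\<tau>\<^sub>y\<^esub>\<close>, \<open>I\<^bsub>\<tau>\<^sub>y\<inverse>\<^esub>\<close> form a single family indexed by arrows, and likewise the
  maps \<open>\<gamma>\<^bsub>\<tau>\<^sub>y\<^esub>\<close>, \<open>\<gamma>\<^sub>h\<close>. No two of these index sets overlap except in \<open>x = \<tau>\<^sub>x = \<tau>\<^sub>x\<inverse>\<close>, where the
  ideals (and maps) are required to agree; in particular \<open>I\<^sub>x = I\<^bsub>\<tau>\<^sub>x\<^esub>\<close> is built in. Values at other
  arrows play no role.\<close>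

locale lifting_datum =
  fixes G :: "('g, 'm) arrow_structure_scheme" and x :: 'g and \<tau> :: "'g \<Rightarrow> 'g"
    and A :: "('a, 'n) ring_scheme" and I :: "'g \<Rightarrow> 'a set" and \<gamma> :: "'g \<Rightarrow> 'a \<rightharpoonup> 'a"
  assumes ideals: "y \<in> objects G \<Longrightarrow> rng_ideal (I y) A"
    and isos: "y \<in> objects G \<Longrightarrow> rng_iso A (I (ginv G (\<tau> y))) (I (\<tau> y)) (\<gamma> (\<tau> y))"
    and action: "group_partial_action (isotropy G x) (A\<lparr>carrier := I x\<rparr>) I \<gamma>"
    and identity: "\<gamma> x = Some |` I x"
    and ideal_tau: "y \<in> objects G \<Longrightarrow> rng_ideal (I (\<tau> y)) (A\<lparr>carrier := I y\<rparr>)"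
    and ideal_tau_inv: "y \<in> objects G \<Longrightarrow> rng_ideal (I (ginv G (\<tau> y))) (A\<lparr>carrier := I x\<rparr>)"
    and ideal_range: "g \<in> carrier G \<Longrightarrow>
      rng_ideal
        (ran (\<gamma> (\<tau> (tgt G g)) |` (I (ginv G (\<tau> (tgt G g))) \<inter>
          ran (\<gamma> (loop_of G \<tau> g) |` (I (ginv G (\<tau> (src G g))) \<inter> I (ginv G (loop_of G \<tau> g)))))))
        (A\<lparr>carrier := I (tgt G g)\<rparr>)"

definition lifted_map ::
    "('g, 'm) arrow_structure_scheme \<Rightarrow> ('g \<Rightarrow> 'g) \<Rightarrow> ('g \<Rightarrow> 'a set) \<Rightarrow> ('g \<Rightarrow> 'a \<rightharpoonup> 'a) \<Rightarrow> 'g \<Rightarrow> 'a \<rightharpoonup> 'a"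
  where
  "lifted_map G \<tau> I \<gamma> g =
     (if g \<in> objects G then Some |` I g
      else \<gamma> (\<tau> (tgt G g)) \<circ>\<^sub>m \<gamma> (loop_of G \<tau> g) \<circ>\<^sub>m partial_inverse (\<gamma> (\<tau> (src G g))))"

definition gamma_unital ::
    "('g, 'm) arrow_structure_scheme \<Rightarrow> 'g \<Rightarrow> ('a, 'n) ring_scheme \<Rightarrow> ('g \<Rightarrow> 'a set) \<Rightarrow> ('g \<Rightarrow> 'a \<rightharpoonup> 'a) \<Rightarrow> bool"
  where
  "gamma_unital G x A I \<gamma> \<longleftrightarrow> unital_rng (A\<lparr>carrier := I x\<rparr>) \<and>
     unital_group_partial_action (isotropy G x) (A\<lparr>carrier := I x\<rparr>) I \<gamma>"


section \<open>The partial skew groupoid ring\<close>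

text \<open>For a finite groupoid \<open>G\<close>. The element \<open>\<Sum>\<^sub>g a\<^sub>g\<delta>\<^sub>g\<close> is the function \<open>g \<mapsto> a\<^sub>g\<close> on the arrows
  of \<open>G\<close> (with no finiteness condition on the support, as \<open>G\<close> is finite).\<close>

definition unit_at :: "('a, 'n) ring_scheme \<Rightarrow> ('g \<Rightarrow> 'a set) \<Rightarrow> 'g \<Rightarrow> 'a" where
  "unit_at A B g = identity_of (A\<lparr>carrier := B g\<rparr>)"

definition skew_ring ::
    "('g, 'm) arrow_structure_scheme \<Rightarrow> ('a, 'n) ring_scheme \<Rightarrow> ('g \<Rightarrow> 'a set) \<Rightarrow> ('g \<Rightarrow> 'a \<rightharpoonup> 'a)
      \<Rightarrow> ('g \<Rightarrow> 'a) ring" where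
  "skew_ring G A B \<beta> =
     \<lparr>carrier = PiE (carrier G) B,
      monoid.mult = (\<lambda>a b. \<lambda>k\<in>carrier G.
        finsum A (\<lambda>(g, h). a g \<otimes>\<^bsub>A\<^esub> the (\<beta> g (b h \<otimes>\<^bsub>A\<^esub> unit_at A B (ginv G g))))
          {(g, h). g \<in> carrier G \<and> h \<in> carrier G \<and> src G g = tgt G h \<and> g \<odot>\<^bsub>G\<^esub> h = k}),
      one = (\<lambda>g\<in>carrier G. if g \<in> objects G then unit_at A B g else \<zero>\<^bsub>A\<^esub>),
      ring.zero = (\<lambda>g\<in>carrier G. \<zero>\<^bsub>A\<^esub>),
      ring.add = (\<lambda>a b. \<lambda>g\<in>carrier G. a g \<oplus>\<^bsub>A\<^esub> b g)\<rparr>"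

text \<open>\<open>a \<mapsto> \<Sum>\<^sub>y (a 1\<^sub>y)\<delta>\<^sub>y\<close>, the sum ranging over the objects.\<close>

definition skew_embedding ::
    "('g, 'm) arrow_structure_scheme \<Rightarrow> ('a, 'n) ring_scheme \<Rightarrow> ('g \<Rightarrow> 'a set) \<Rightarrow> 'a \<Rightarrow> 'g \<Rightarrow> 'a" where
  "skew_embedding G A B a =
     (\<lambda>g\<in>carrier G. if g \<in> objects G then a \<otimes>\<^bsub>A\<^esub> unit_at A B g else \<zero>\<^bsub>A\<^esub>)"

text \<open>The element \<open>b\<delta>\<^sub>k\<close>.\<close>

definition delta ::
    "('g, 'm) arrow_structure_scheme \<Rightarrow> ('a, 'n) ring_scheme \<Rightarrow> 'g \<Rightarrow> 'a \<Rightarrow> 'g \<Rightarrow> 'a" where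
  "delta G A k b = (\<lambda>g\<in>carrier G. if g = k then b else \<zero>\<^bsub>A\<^esub>)"


section \<open>Frobenius extensions\<close>

text \<open>Ring extensions \<open>R \<subset> S\<close> are given by an embedding \<open>\<phi>\<close>; \<open>ring\<close> and \<open>ring_hom\<close> are the unital
  notions.\<close>

definition ring_extension ::
    "('r, 'm) ring_scheme \<Rightarrow> ('s, 'n) ring_scheme \<Rightarrow> ('r \<Rightarrow> 's) \<Rightarrow> bool" where
  "ring_extension R S \<phi> \<longleftrightarrow> ring R \<and> ring S \<and> \<phi> \<in> ring_hom R S \<and> inj_on \<phi> (carrier R)"

text \<open>The additive group of \<open>S \<otimes>\<^sub>R S\<close>, written multiplicatively: the free abelian group on pairs
  modulo bilinearity and \<open>R\<close>-balancedness.\<close>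

definition tensor_relations ::
    "('r, 'm) ring_scheme \<Rightarrow> ('s, 'n) ring_scheme \<Rightarrow> ('r \<Rightarrow> 's) \<Rightarrow> ('s \<times> 's \<Rightarrow>\<^sub>0 int) set" where
  "tensor_relations R S \<phi> =
     {frag_of (a \<oplus>\<^bsub>S\<^esub> a', b) - frag_of (a, b) - frag_of (a', b) | a a' b.
        a \<in> carrier S \<and> a' \<in> carrier S \<and> b \<in> carrier S} \<union>
     {frag_of (a, b \<oplus>\<^bsub>S\<^esub> b') - frag_of (a, b) - frag_of (a, b') | a b b'.
        a \<in> carrier S \<and> b \<in> carrier S \<and> b' \<in> carrier S} \<union>
     {frag_of (a \<otimes>\<^bsub>S\<^esub> \<phi> r, b) - frag_of (a, \<phi> r \<otimes>\<^bsub>S\<^esub> b) | a b r.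
        a \<in> carrier S \<and> b \<in> carrier S \<and> r \<in> carrier R}"

definition tensor_kernel ::
    "('r, 'm) ring_scheme \<Rightarrow> ('s, 'n) ring_scheme \<Rightarrow> ('r \<Rightarrow> 's) \<Rightarrow> ('s \<times> 's \<Rightarrow>\<^sub>0 int) set" where
  "tensor_kernel R S \<phi> =
     generate (free_Abelian_group (carrier S \<times> carrier S)) (tensor_relations R S \<phi>)"

definition tensor_square ::
    "('r, 'm) ring_scheme \<Rightarrow> ('s, 'n) ring_scheme \<Rightarrow> ('r \<Rightarrow> 's) \<Rightarrow> ('s \<times> 's \<Rightarrow>\<^sub>0 int) set monoid" where
  "tensor_square R S \<phi> = free_Abelian_group (carrier S \<times> carrier S) Mod tensor_kernel R S \<phi>"

definition pure_tensor ::
    "('r, 'm) ring_scheme \<Rightarrow> ('s, 'n) ring_scheme \<Rightarrow> ('r \<Rightarrow> 's) \<Rightarrow> 's \<Rightarrow> 's \<Rightarrow> ('s \<times> 's \<Rightarrow>\<^sub>0 int) set" where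
  "pure_tensor R S \<phi> a b =
     tensor_kernel R S \<phi> #>\<^bsub>free_Abelian_group (carrier S \<times> carrier S)\<^esub> frag_of (a, b)"

definition bimodule_map ::
    "('r, 'm) ring_scheme \<Rightarrow> ('s, 'n) ring_scheme \<Rightarrow> ('r \<Rightarrow> 's) \<Rightarrow> ('s \<Rightarrow> 'r) \<Rightarrow> bool" where
  "bimodule_map R S \<phi> \<epsilon> \<longleftrightarrow> \<epsilon> \<in> carrier S \<rightarrow> carrier R \<and>
     (\<forall>s\<in>carrier S. \<forall>s'\<in>carrier S. \<epsilon> (s \<oplus>\<^bsub>S\<^esub> s') = \<epsilon> s \<oplus>\<^bsub>R\<^esub> \<epsilon> s') \<and>
     (\<forall>r\<in>carrier R. \<forall>s\<in>carrier S. \<epsilon> (\<phi> r \<otimes>\<^bsub>S\<^esub> s) = r \<otimes>\<^bsub>R\<^esub> \<epsilon> s \<and>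
        \<epsilon> (s \<otimes>\<^bsub>S\<^esub> \<phi> r) = \<epsilon> s \<otimes>\<^bsub>R\<^esub> r)"

text \<open>For \<open>u = \<Sum>\<^sub>i p\<^sub>i \<otimes> q\<^sub>i\<close> the condition \<open>su = us\<close> reads \<open>\<Sum>\<^sub>i sp\<^sub>i \<otimes> q\<^sub>i = \<Sum>\<^sub>i p\<^sub>i \<otimes> q\<^sub>is\<close>, by the
  definition of the bimodule structure of \<open>S \<otimes>\<^sub>R S\<close>; sums in \<open>S \<otimes>\<^sub>R S\<close> are \<open>finprod\<close> because the
  group is written multiplicatively.\<close>

definition frobenius_extension ::
    "('r, 'm) ring_scheme \<Rightarrow> ('s, 'n) ring_scheme \<Rightarrow> ('r \<Rightarrow> 's) \<Rightarrow> bool" where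
  "frobenius_extension R S \<phi> \<longleftrightarrow> ring_extension R S \<phi> \<and>
     (\<exists>(n::nat) p q \<epsilon>.
        (\<forall>i<n. p i \<in> carrier S \<and> q i \<in> carrier S) \<and>
        bimodule_map R S \<phi> \<epsilon> \<and>
        (\<forall>s\<in>carrier S.
           finprod (tensor_square R S \<phi>) (\<lambda>i. pure_tensor R S \<phi> (s \<otimes>\<^bsub>S\<^esub> p i) (q i)) {..<n} =
           finprod (tensor_square R S \<phi>) (\<lambda>i. pure_tensor R S \<phi> (p i) (q i \<otimes>\<^bsub>S\<^esub> s)) {..<n}) \<and>
        finsum S (\<lambda>i. \<phi> (\<epsilon> (p i)) \<otimes>\<^bsub>S\<^esub> q i) {..<n} = \<one>\<^bsub>S\<^esub> \<and>
        finsum S (\<lambda>i. p i \<otimes>\<^bsub>S\<^esub> \<phi> (\<epsilon> (q i))) {..<n} = \<one>\<^bsub>S\<^esub>)"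

end

theory Submission
  imports Defs
begin

text \<open>Both extensions are instances of one fact: if a finite groupoid acts partially and unitally
  on \<open>A = \<Oplus>\<^sub>y B\<^sub>y\<close>, then \<open>A \<subset> A \<star> G\<close> is Frobenius, with \<open>\<epsilon> (\<Sum>\<^sub>g a\<^sub>g\<delta>\<^sub>g) = \<Sum>\<^sub>y a\<^sub>y\<close> and
  \<open>u = \<Sum>\<^sub>g 1\<^sub>g\<delta>\<^sub>g \<otimes> 1\<^bsub>g\<inverse>\<^esub>\<delta>\<^bsub>g\<inverse>\<^esub>\<close>. Writing \<open>\<theta>\<^sub>g a = \<beta>\<^sub>g (a 1\<^bsub>g\<inverse>\<^esub>)\<close>, one has
  \<open>\<theta>\<^sub>g \<theta>\<^sub>h a = 1\<^sub>g \<theta>\<^bsub>gh\<^esub> a\<close>; this gives associativity, and \<open>su = us\<close> for \<open>s = a\<delta>\<^sub>h\<close> follows by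
  substituting \<open>k = hg\<close> and moving \<open>\<theta>\<^bsub>k\<inverse>\<^esub> a \<in> A\<close> across the tensor sign. Globality makes each
  \<open>\<gamma>\<^bsub>\<tau>\<^sub>y\<^esub>\<close> an isomorphism \<open>I\<^sub>x \<rightarrow> I\<^sub>y\<close>, so the lifted action is conjugate to the action of the
  isotropy group and is unital with it.\<close>

section \<open>Groupoids\<close>

text \<open>A partial action only makes \<beta>_(gh) an extension of \<beta>_g \<beta>_h, so every
  computation would carry domain conditions. Extending \<beta>_g by zero to all of A trades these
  for central idempotents; the factor 1_g in the composition rule is the price, and it is absorbed
  by any coefficient from B_g standing next to it. The tensor u commutes with a\<delta>_h because
  one element b = \<theta>_(k^-1) a, with k = hg, serves on both sides: (a\<delta>_h)(1_g\<delta>_g)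
  = (1_k\<delta>_k) b, and b (1_(g^-1)\<delta>_(g^-1)) = (1_(k^-1)\<delta>_(k^-1))(a\<delta>_h). The
  direct sum gives A the identity \<Sum>_y 1_y and makes \<epsilon> a left inverse of the embedding.
  For the isotropy group, a groupoid with one object, the corresponding decomposition of B_x is
  trivial, so the general fact covers it. Globality is stated for the ranges of the lifted maps and
  has to be converted into a statement on the datum. Without it these ranges would be images of
  intersections with ideals for which no identity is assumed.\<close>

context groupoid
begin

declare src_closed [simp] tgt_closed [simp] src_src [simp] tgt_src [simp] src_tgt [simp]
  tgt_tgt [simp] cmp_closed [simp] src_cmp [simp] tgt_cmp [simp] cmp_src [simp] tgt_cmp_self [simp]

lemma is_inverse_unique:
  assumes g: "g \<in> carrier G" and h: "is_inverse G g h" and k: "is_inverse G g k"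
  shows "h = k"
proof -
  have "h = h \<odot> (g \<odot> k)"
    using g h k cmp_src[of h] by (metis is_inverse_def)
  also have "\<dots> = (h \<odot> g) \<odot> k"
    using g h k cmp_assoc[of h g k] by (simp add: is_inverse_def)
  also have "\<dots> = k"
    using g h k tgt_cmp_self[of k] by (metis is_inverse_def)
  finally show ?thesis .
qed

lemma is_inverse_ginv: "g \<in> carrier G \<Longrightarrow> is_inverse G g (ginv G g)"
  unfolding ginv_def by (rule theI') (metis ex_inverse is_inverse_unique)

lemma ginv_eqI: "g \<in> carrier G \<Longrightarrow> is_inverse G g h \<Longrightarrow> ginv G g = h"
  using is_inverse_ginv is_inverse_unique by blast

lemma
  assumes "g \<in> carrier G"
  shows ginv_closed [simp]: "ginv G g \<in> carrier G"
    and src_ginv [simp]: "src G (ginv G g) = tgt G g"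
    and tgt_ginv [simp]: "tgt G (ginv G g) = src G g"
    and ginv_cmp [simp]: "ginv G g \<odot> g = src G g"
    and cmp_ginv [simp]: "g \<odot> ginv G g = tgt G g"
  using is_inverse_ginv[OF assms] by (auto simp: is_inverse_def)

lemma ginv_ginv [simp]: "g \<in> carrier G \<Longrightarrow> ginv G (ginv G g) = g"
  by (rule ginv_eqI) (auto simp: is_inverse_def)

lemma ginv_cmp_cancel [simp]:
  "\<lbrakk>g \<in> carrier G; k \<in> carrier G; src G g = tgt G k\<rbrakk> \<Longrightarrow> ginv G g \<odot> (g \<odot> k) = k"
  by (simp flip: cmp_assoc)

lemma cmp_ginv_cancel [simp]:
  "\<lbrakk>g \<in> carrier G; k \<in> carrier G; tgt G g = tgt G k\<rbrakk> \<Longrightarrow> g \<odot> (ginv G g \<odot> k) = k"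
  by (simp flip: cmp_assoc)

lemma ginv_cmp_distrib:
  assumes "g \<in> carrier G" "h \<in> carrier G" "src G g = tgt G h"
  shows "ginv G (g \<odot> h) = ginv G h \<odot> ginv G g"
  using assms by (intro ginv_eqI) (auto simp: is_inverse_def cmp_assoc)

lemma in_objects_iff: "y \<in> objects G \<longleftrightarrow> y \<in> carrier G \<and> src G y = y"
  by (force simp: objects_def)

lemma
  assumes "y \<in> objects G"
  shows object_carrier [simp]: "y \<in> carrier G"
    and src_object [simp]: "src G y = y"
    and tgt_object [simp]: "tgt G y = y"
  using assms tgt_src by (fastforce simp: objects_def)+

lemma object_cmp [simp]: "\<lbrakk>y \<in> objects G; g \<in> carrier G; tgt G g = y\<rbrakk> \<Longrightarrow> y \<odot> g = g"
  using tgt_cmp_self by blast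

lemma ginv_object [simp]: "y \<in> objects G \<Longrightarrow> ginv G y = y"
  using cmp_src[of y] by (intro ginv_eqI) (auto simp: is_inverse_def)

lemma src_in_objects [simp]: "g \<in> carrier G \<Longrightarrow> src G g \<in> objects G"
  unfolding objects_def by (rule imageI)

lemma tgt_in_objects [simp]: "g \<in> carrier G \<Longrightarrow> tgt G g \<in> objects G"
  using src_tgt tgt_closed in_objects_iff by blast

lemma carrier_isotropy [simp]: "carrier (isotropy G x) = arrows G x x"
  and src_isotropy [simp]: "src (isotropy G x) = src G"
  and tgt_isotropy [simp]: "tgt (isotropy G x) = tgt G"
  and cmp_isotropy [simp]: "g \<odot>\<^bsub>isotropy G x\<^esub> h = g \<odot> h"
  by (simp_all add: isotropy_def)

lemma is_inverse_isotropy: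
  "g \<in> arrows G x x \<Longrightarrow> is_inverse (isotropy G x) g h \<longleftrightarrow> is_inverse G g h"
  by (auto simp: is_inverse_def arrows_def)

lemma ginv_isotropy [simp]: "g \<in> arrows G x x \<Longrightarrow> ginv (isotropy G x) g = ginv G g"
  by (simp add: ginv_def is_inverse_isotropy)

text \<open>Keeping the isotropy group as a groupoid lets everything proved for partial actions of
  groupoids apply to it directly.\<close>

lemma groupoid_isotropy: "groupoid (isotropy G x)"
proof
  fix g assume "g \<in> carrier (isotropy G x)"
  then show "\<exists>h. is_inverse (isotropy G x) g h"
    by (auto simp: is_inverse_isotropy arrows_def intro: ex_inverse)
qed (auto simp: arrows_def cmp_assoc dest: cmp_src tgt_cmp_self)

lemma objects_isotropy [simp]: "x \<in> objects G \<Longrightarrow> objects (isotropy G x) = {x}"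
proof -
  assume x: "x \<in> objects G"
  have "src G ` arrows G x x = {x}"
    using x imageI[of x "arrows G x x" "src G"] by (auto simp: arrows_def)
  then show ?thesis by (simp add: objects_def[of "isotropy G x"])
qed

end


section \<open>Rings without identity\<close>

context rng
begin

declare rng_closed [simp, intro]

lemma rng_l_null [simp]:
  assumes "a \<in> carrier R" shows "\<zero> \<otimes> a = \<zero>"
proof -
  have "\<zero> \<otimes> a \<oplus> \<zero> \<otimes> a = \<zero> \<otimes> a \<oplus> \<zero>"
    using assms rng_l_distr[of \<zero> \<zero> a] by simp
  with assms show ?thesis by (simp del: r_zero)
qed

lemma rng_r_null [simp]:
  assumes "a \<in> carrier R" shows "a \<otimes> \<zero> = \<zero>"
proof -
  have "a \<otimes> \<zero> \<oplus> a \<otimes> \<zero> = a \<otimes> \<zero> \<oplus> \<zero>"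
    using assms rng_r_distr[of \<zero> \<zero> a] by simp
  with assms show ?thesis by (simp del: r_zero)
qed

lemma rng_finsum_ldistr:
  assumes "finite T" "a \<in> carrier R" "f \<in> T \<rightarrow> carrier R"
  shows "finsum R f T \<otimes> a = finsum R (\<lambda>i. f i \<otimes> a) T"
  using assms
proof (induction T)
  case (insert i T)
  then have "f i \<in> carrier R" "f \<in> T \<rightarrow> carrier R" "(\<lambda>i. f i \<otimes> a) \<in> T \<rightarrow> carrier R"
    by auto
  with insert show ?case by (simp add: rng_l_distr)
qed simp

lemma rng_finsum_rdistr:
  assumes "finite T" "a \<in> carrier R" "f \<in> T \<rightarrow> carrier R"
  shows "a \<otimes> finsum R f T = finsum R (\<lambda>i. a \<otimes> f i) T"
  using assms
proof (induction T)
  case (insert i T)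
  then have "f i \<in> carrier R" "f \<in> T \<rightarrow> carrier R" "(\<lambda>i. a \<otimes> f i) \<in> T \<rightarrow> carrier R"
    by auto
  with insert show ?case by (simp add: rng_r_distr)
qed simp

lemma rng_idealD:
  assumes "rng_ideal J R"
  shows "J \<subseteq> carrier R" "\<zero> \<in> J" "\<And>a b. \<lbrakk>a \<in> J; b \<in> J\<rbrakk> \<Longrightarrow> a \<oplus> b \<in> J"
    "\<And>a. a \<in> J \<Longrightarrow> \<ominus> a \<in> J"
    "\<And>a r. \<lbrakk>a \<in> J; r \<in> carrier R\<rbrakk> \<Longrightarrow> r \<otimes> a \<in> J" "\<And>a r. \<lbrakk>a \<in> J; r \<in> carrier R\<rbrakk> \<Longrightarrow> a \<otimes> r \<in> J"
proof -
  interpret additive_subgroup J R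
    using assms by (simp add: rng_ideal_def)
  show "J \<subseteq> carrier R" by (rule a_subset)
  show "\<zero> \<in> J" by simp
  show "\<And>a b. \<lbrakk>a \<in> J; b \<in> J\<rbrakk> \<Longrightarrow> a \<oplus> b \<in> J" by simp
  show "\<And>a. a \<in> J \<Longrightarrow> \<ominus> a \<in> J"
    using subgroup.m_inv_closed[OF a_subgroup] by (simp add: a_inv_def)
  show "\<And>a r. \<lbrakk>a \<in> J; r \<in> carrier R\<rbrakk> \<Longrightarrow> r \<otimes> a \<in> J" "\<And>a r. \<lbrakk>a \<in> J; r \<in> carrier R\<rbrakk> \<Longrightarrow> a \<otimes> r \<in> J"
    using assms by (auto simp: rng_ideal_def)
qed

lemma rng_rng_ideal:
  assumes J: "rng_ideal J R" shows "rng (R\<lparr>carrier := J\<rparr>)"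
proof -
  note D = rng_idealD[OF J]
  interpret J: abelian_group "R\<lparr>carrier := J\<rparr>"
  proof (rule abelian_groupI)
    fix a assume "a \<in> carrier (R\<lparr>carrier := J\<rparr>)"
    then have "\<ominus> a \<in> J" "\<ominus> a \<oplus> a = \<zero>"
      using D by (auto intro!: l_neg)
    then show "\<exists>b\<in>carrier (R\<lparr>carrier := J\<rparr>). b \<oplus>\<^bsub>R\<lparr>carrier := J\<rparr>\<^esub> a = \<zero>\<^bsub>R\<lparr>carrier := J\<rparr>\<^esub>"
      by auto
  qed (use D in \<open>auto simp: subset_iff a_assoc intro: a_comm\<close>)
  show ?thesis
    by unfold_locales (use D in \<open>auto simp: subset_iff rng_assoc rng_l_distr rng_r_distr\<close>)
qed

end

lemma is_identity_unique: "is_identity R e \<Longrightarrow> is_identity R e' \<Longrightarrow> e = e'"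
  unfolding is_identity_def by (rule trans[of _ "e \<otimes>\<^bsub>R\<^esub> e'"]) auto

lemma identity_of_eq: "is_identity R e \<Longrightarrow> identity_of R = e"
  unfolding identity_of_def by (rule the_equality) (auto intro: is_identity_unique)

lemma is_identity_identity_of: "unital_rng R \<Longrightarrow> is_identity R (identity_of R)"
  unfolding unital_rng_def by (auto simp: identity_of_eq)

text \<open>Transitivity of ideals fails in general; an identity of the smaller ideal rescues it.\<close>

lemma (in rng) rng_ideal_trans:
  assumes J: "rng_ideal J R" and K: "rng_ideal K (R\<lparr>carrier := J\<rparr>)"
    and e: "is_identity (R\<lparr>carrier := K\<rparr>) e"
  shows "rng_ideal K R" "central_idempotent R e"
proof -
  note DJ = rng_idealD[OF J]
  interpret J: rng "R\<lparr>carrier := J\<rparr>" by (rule rng_rng_ideal[OF J])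
  note DK = J.rng_idealD[OF K, simplified]
  have KR: "K \<subseteq> carrier R" using DJ DK by auto
  have e': "e \<in> K" "\<And>a. a \<in> K \<Longrightarrow> e \<otimes> a = a" "\<And>a. a \<in> K \<Longrightarrow> a \<otimes> e = a"
    using e by (auto simp: is_identity_def)
  have l: "r \<otimes> a \<in> K" if "a \<in> K" "r \<in> carrier R" for a r
  proof -
    \<comment> \<open>The identity \<open>e\<close> carries the outside factor into
      \<open>J\<close>: \<open>r \<otimes> e\<close> lies in \<open>J\<close>, and \<open>K\<close>
      absorbs products with \<open>J\<close>.\<close>
    have "r \<otimes> a = (r \<otimes> e) \<otimes> a"
      using that e' KR by (subst rng_assoc) auto
    also have "\<dots> \<in> K"
      using that e'(1) DJ(5) DK(1) by (intro DK(5)) auto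
    finally show ?thesis .
  qed
  have r: "a \<otimes> r \<in> K" if "a \<in> K" "r \<in> carrier R" for a r
  proof -
    have "a \<otimes> r = a \<otimes> (e \<otimes> r)"
      using that e' KR by (subst rng_assoc[symmetric]) auto
    also have "\<dots> \<in> K"
      using that e'(1) DJ(6) DK(1) by (intro DK(6)) auto
    finally show ?thesis .
  qed
  have "subgroup K (add_monoid R)"
  proof (rule add.subgroupI)
    fix a assume a: "a \<in> K"
    have "\<ominus>\<^bsub>R\<lparr>carrier := J\<rparr>\<^esub> a \<in> K" using DK a by simp
    \<comment> \<open>Negation is defined relative to the carrier of a record, so the negatives
      formed in \<open>J\<close> and in \<open>R\<close> have to be identified.\<close>
    moreover have "\<ominus>\<^bsub>R\<lparr>carrier := J\<rparr>\<^esub> a = \<ominus> a"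
    proof (rule sym, rule minus_equality)
      show "\<ominus>\<^bsub>R\<lparr>carrier := J\<rparr>\<^esub> a \<oplus> a = \<zero>"
        using J.l_neg[of a] a DK by auto
    qed (use a DK KR in auto)
    ultimately show "\<ominus> a \<in> K" by simp
  qed (use DK KR e' in auto)
  then show "rng_ideal K R"
    using l r by (auto simp: rng_ideal_def additive_subgroup_def)
  \<comment> \<open>Both \<open>e \<otimes> a\<close> and \<open>a \<otimes> e\<close> lie in
    \<open>K\<close>, on which \<open>e\<close> is an identity, so both equal the product of
    \<open>e\<close>, \<open>a\<close>, \<open>e\<close>: an identity of an ideal is automatically
    central.\<close>
  have "e \<otimes> a = a \<otimes> e" if a: "a \<in> carrier R" for a
  proof -
    have "e \<otimes> a = (e \<otimes> a) \<otimes> e"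
      using e'(3)[OF r[OF e'(1) a]] by simp
    also have "\<dots> = e \<otimes> (a \<otimes> e)"
      using a e'(1) KR by (auto intro: rng_assoc)
    also have "\<dots> = a \<otimes> e"
      by (rule e'(2)[OF l[OF e'(1) a]])
    finally show ?thesis .
  qed
  then show "central_idempotent R e"
    using e' KR by (auto simp: central_idempotent_def)
qed

lemma ring_iso_pair_iff:
  "f \<in> iso (R\<lparr>carrier := P\<rparr>) (R\<lparr>carrier := Q\<rparr>) \<and>
     f \<in> iso (add_monoid (R\<lparr>carrier := P\<rparr>)) (add_monoid (R\<lparr>carrier := Q\<rparr>)) \<longleftrightarrow>
   bij_betw f P Q \<and> (\<forall>a\<in>P. \<forall>b\<in>P. f (a \<otimes>\<^bsub>R\<^esub> b) = f a \<otimes>\<^bsub>R\<^esub> f b) \<and>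
     (\<forall>a\<in>P. \<forall>b\<in>P. f (a \<oplus>\<^bsub>R\<^esub> b) = f a \<oplus>\<^bsub>R\<^esub> f b)"
  using bij_betw_imp_funcset[of f P Q] by (auto simp: iso_def hom_def)

lemma rng_iso_iff:
  "rng_iso R P Q u \<longleftrightarrow> dom u = P \<and> bij_betw (\<lambda>a. the (u a)) P Q \<and>
     (\<forall>a\<in>P. \<forall>b\<in>P. the (u (a \<otimes>\<^bsub>R\<^esub> b)) = the (u a) \<otimes>\<^bsub>R\<^esub> the (u b)) \<and>
     (\<forall>a\<in>P. \<forall>b\<in>P. the (u (a \<oplus>\<^bsub>R\<^esub> b)) = the (u a) \<oplus>\<^bsub>R\<^esub> the (u b))"
  unfolding rng_iso_def ring_iso_pair_iff ..


section \<open>Finite sums\<close>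

lemma (in abelian_monoid) finsum_swap:
  assumes "finite X" "finite Y" "\<And>i j. \<lbrakk>i \<in> X; j \<in> Y\<rbrakk> \<Longrightarrow> f i j \<in> carrier G"
  shows "(\<Oplus>i\<in>X. \<Oplus>j\<in>Y. f i j) = (\<Oplus>j\<in>Y. \<Oplus>i\<in>X. f i j)"
  using assms(1,3)
proof (induction X)
  case (insert i X)
  have "(\<Oplus>i\<in>insert i X. \<Oplus>j\<in>Y. f i j) = (\<Oplus>j\<in>Y. f i j) \<oplus> (\<Oplus>i\<in>X. \<Oplus>j\<in>Y. f i j)"
    using insert by (intro finsum_insert) (auto intro!: finsum_closed)
  also have "\<dots> = (\<Oplus>j\<in>Y. f i j) \<oplus> (\<Oplus>j\<in>Y. \<Oplus>i\<in>X. f i j)"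
    using insert by simp
  also have "\<dots> = (\<Oplus>j\<in>Y. f i j \<oplus> (\<Oplus>i\<in>X. f i j))"
    using insert by (intro finsum_addf[symmetric]) (auto intro!: finsum_closed)
  also have "\<dots> = (\<Oplus>j\<in>Y. \<Oplus>i\<in>insert i X. f i j)"
    using insert by (intro finsum_cong' finsum_insert[symmetric]) (auto intro!: finsum_closed)
  finally show ?case .
qed simp

lemma (in abelian_monoid) finsum_single:
  assumes "finite X" "i \<in> X" "f i \<in> carrier G" "\<And>j. \<lbrakk>j \<in> X; j \<noteq> i\<rbrakk> \<Longrightarrow> f j = \<zero>"
  shows "finsum G f X = f i"
proof -
  have "finsum G f X = finsum G (\<lambda>j. if i = j then f i else \<zero>) X"
    using assms by (intro finsum_cong') auto
  also have "\<dots> = f i"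
    using finsum_singleton[OF assms(2,1), of "\<lambda>j. f i"] assms(3) by simp
  finally show ?thesis .
qed

text \<open>Applied with \<open>C\<close> an ideal \<open>B k\<close>, to see that products stay in
  the skew ring, and with \<open>C\<close> the set of elements commuting with the Frobenius
  tensor.\<close>

lemma (in abelian_monoid) finsum_mem:
  assumes "finite X" "C \<subseteq> carrier G" "\<zero> \<in> C" "\<And>a b. \<lbrakk>a \<in> C; b \<in> C\<rbrakk> \<Longrightarrow> a \<oplus> b \<in> C"
    and "\<And>i. i \<in> X \<Longrightarrow> f i \<in> C"
  shows "finsum G f X \<in> C"
  using assms(1,5)
proof (induction X)
  case (insert i X)
  then have "finsum G f (insert i X) = f i \<oplus> finsum G f X"
    using assms(2) by (intro finsum_insert) auto
  then show ?case using insert assms(4) by simp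
qed (simp add: assms(3))


section \<open>Unital partial actions\<close>

text \<open>The common setting of both extensions. No transversal or lifting datum occurs, so
  \<open>G\<close> may be the whole groupoid or an isotropy group.\<close>

locale unital_partial_action = rng A + groupoid G
  for A :: "('a, 'n) ring_scheme" and G :: "('g, 'm) arrow_structure_scheme" +
  fixes B :: "'g \<Rightarrow> 'a set" and \<beta> :: "'g \<Rightarrow> 'a \<rightharpoonup> 'a"
  assumes finite_arrows: "finite (carrier G)"
    and partial_action: "partial_action G A B \<beta>"
    and unital: "g \<in> carrier G \<Longrightarrow> unital_rng (A\<lparr>carrier := B g\<rparr>)"
    and direct_sum: "internal_direct_sum A (objects G) B"
begin

abbreviation times (infixl "\<cdot>" 70) where "a \<cdot> b \<equiv> a \<otimes>\<^bsub>A\<^esub> b"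
abbreviation plus (infixl "\<^bold>+" 65) where "a \<^bold>+ b \<equiv> a \<oplus>\<^bsub>A\<^esub> b"
abbreviation comp (infixl "\<star>" 75) where "g \<star> h \<equiv> g \<odot>\<^bsub>G\<^esub> h"
abbreviation inv ("_\<^sup>-" [1000] 999) where "g\<^sup>- \<equiv> ginv G g"
abbreviation idem where "idem g \<equiv> unit_at A B g"
abbreviation act where "act g a \<equiv> the (\<beta> g a)"

text \<open>The extension of \<open>\<beta>\<^sub>g\<close> to an endomorphism of \<open>A\<close> that kills the complement of \<open>B\<^bsub>g\<inverse>\<^esub>\<close>.\<close>

definition translate :: "'g \<Rightarrow> 'a \<Rightarrow> 'a" where
  "translate g a = act g (a \<cdot> idem (g\<^sup>-))"

lemma idem_identity: "g \<in> carrier G \<Longrightarrow> is_identity (A\<lparr>carrier := B g\<rparr>) (idem g)"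
  unfolding unit_at_def by (intro is_identity_identity_of unital)

text \<open>A partial action makes \<open>B g\<close> an ideal of \<open>B (tgt G g)\<close>, itself
  an ideal of \<open>A\<close>. The identity of \<open>B g\<close> bridges the two levels and is
  thereby central in all of \<open>A\<close>.\<close>

lemma B_ideal: "g \<in> carrier G \<Longrightarrow> rng_ideal (B g) A"
  and idem_central: "g \<in> carrier G \<Longrightarrow> central_idempotent A (idem g)"
  using rng_ideal_trans[OF _ _ idem_identity] partial_action by (auto simp: partial_action_def)

lemma
  assumes "g \<in> carrier G"
  shows B_carrier: "a \<in> B g \<Longrightarrow> a \<in> carrier A"
    and zero_B [simp]: "\<zero>\<^bsub>A\<^esub> \<in> B g"
    and plus_B [simp]: "\<lbrakk>a \<in> B g; b \<in> B g\<rbrakk> \<Longrightarrow> a \<^bold>+ b \<in> B g"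
    and minus_B [simp]: "a \<in> B g \<Longrightarrow> \<ominus>\<^bsub>A\<^esub> a \<in> B g"
    and times_B_right [simp]: "\<lbrakk>a \<in> B g; r \<in> carrier A\<rbrakk> \<Longrightarrow> r \<cdot> a \<in> B g"
    and times_B_left [simp]: "\<lbrakk>a \<in> B g; r \<in> carrier A\<rbrakk> \<Longrightarrow> a \<cdot> r \<in> B g"
  using rng_idealD[OF B_ideal[OF assms]] by auto

lemma
  assumes "g \<in> carrier G"
  shows idem_B [simp]: "idem g \<in> B g"
    and idem_carrier [simp]: "idem g \<in> carrier A"
    and idem_times [simp]: "a \<in> B g \<Longrightarrow> idem g \<cdot> a = a"
    and times_idem [simp]: "a \<in> B g \<Longrightarrow> a \<cdot> idem g = a"
    and idem_commute: "a \<in> carrier A \<Longrightarrow> a \<cdot> idem g = idem g \<cdot> a"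
  using idem_identity[OF assms] idem_central[OF assms] B_carrier[OF assms]
  by (auto simp: is_identity_def central_idempotent_def)

lemma act_iso: "g \<in> carrier G \<Longrightarrow> rng_iso A (B (g\<^sup>-)) (B g) (\<beta> g)"
  using partial_action by (auto simp: partial_action_def)

lemma
  assumes "g \<in> carrier G" "a \<in> B (g\<^sup>-)"
  shows act_B: "act g a \<in> B g"
    and act_Some: "\<beta> g a = Some (act g a)"
    and act_times: "b \<in> B (g\<^sup>-) \<Longrightarrow> act g (a \<cdot> b) = act g a \<cdot> act g b"
    and act_plus: "b \<in> B (g\<^sup>-) \<Longrightarrow> act g (a \<^bold>+ b) = act g a \<^bold>+ act g b"
proof -
  have "\<beta> g a \<noteq> None"
    using act_iso[OF assms(1)] assms(2) by (auto simp: rng_iso_iff)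
  then show "\<beta> g a = Some (act g a)" by auto
qed (use act_iso[OF assms(1)] assms(2) in \<open>auto simp: rng_iso_iff dest: bij_betwE\<close>)

lemma act_object: "y \<in> objects G \<Longrightarrow> a \<in> B y \<Longrightarrow> act y a = a"
  using partial_action by (auto simp: partial_action_def)

text \<open>The first conclusion is the source of memberships in ideals of product arrows: the
  composite is defined at \<open>a\<close>, hence so is its extension
  \<open>\<beta> (g \<star> h)\<close>, whose domain is
  \<open>B ((g \<star> h)\<^sup>-)\<close>.\<close>

lemma act_act:
  assumes "g \<in> carrier G" "h \<in> carrier G" "src G g = tgt G h" "a \<in> B (h\<^sup>-)" "act h a \<in> B (g\<^sup>-)"
  shows "a \<in> B ((g \<star> h)\<^sup>-)" "act (g \<star> h) a = act g (act h a)"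
proof -
  have "(\<beta> g \<circ>\<^sub>m \<beta> h) a = Some (act g (act h a))"
    using act_Some[of h a] act_Some[of g "act h a"] assms by (metis map_comp_simps(2))
  moreover have "(\<beta> g \<circ>\<^sub>m \<beta> h) \<subseteq>\<^sub>m \<beta> (g \<star> h)"
    using partial_action assms by (auto simp: partial_action_def)
  ultimately have *: "\<beta> (g \<star> h) a = Some (act g (act h a))"
    by (auto simp: map_le_def dom_def)
  then show "act (g \<star> h) a = act g (act h a)" by simp
  show "a \<in> B ((g \<star> h)\<^sup>-)"
    using * act_iso[of "g \<star> h"] assms by (auto simp: rng_iso_iff)
qed

text \<open>The composite is extended by the map at the object \<open>tgt G g\<close>, which is an
  identity map.\<close>

lemma act_ginv:
  assumes "g \<in> carrier G" "a \<in> B g"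
  shows "act g (act (g\<^sup>-) a) = a"
proof -
  have "act (g\<^sup>-) a \<in> B (g\<^sup>-)"
    using assms by (intro act_B) auto
  then have "a \<in> B ((g \<star> g\<^sup>-)\<^sup>-)" "act (g \<star> g\<^sup>-) a = act g (act (g\<^sup>-) a)"
    using act_act[of g "g\<^sup>-" a] assms by simp_all
  then show ?thesis
    using assms by (simp add: act_object)
qed

section \<open>Calculus of the endomorphisms \<open>translate g\<close>\<close>

lemma translate_eq: "g \<in> carrier G \<Longrightarrow> a \<in> B (g\<^sup>-) \<Longrightarrow> translate g a = act g a"
  by (simp add: translate_def)

lemma translate_B [simp]: "g \<in> carrier G \<Longrightarrow> a \<in> carrier A \<Longrightarrow> translate g a \<in> B g"
  unfolding translate_def by (intro act_B) auto

lemma translate_carrier [simp]: "g \<in> carrier G \<Longrightarrow> a \<in> carrier A \<Longrightarrow> translate g a \<in> carrier A"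
  using B_carrier translate_B by blast

lemma translate_plus:
  "\<lbrakk>g \<in> carrier G; a \<in> carrier A; b \<in> carrier A\<rbrakk>
    \<Longrightarrow> translate g (a \<^bold>+ b) = translate g a \<^bold>+ translate g b"
  by (simp add: translate_def rng_l_distr act_plus)

lemma translate_times:
  assumes "g \<in> carrier G" "a \<in> carrier A" "b \<in> carrier A"
  shows "translate g (a \<cdot> b) = translate g a \<cdot> translate g b"
proof -
  let ?e = "idem (g\<^sup>-)"
  have "(a \<cdot> b) \<cdot> ?e = (a \<cdot> ?e) \<cdot> (b \<cdot> ?e)"
  proof -
    have "(a \<cdot> ?e) \<cdot> (b \<cdot> ?e) = a \<cdot> (?e \<cdot> (b \<cdot> ?e))"
      using assms by (intro rng_assoc) auto
    also have "\<dots> = (a \<cdot> b) \<cdot> ?e"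
      using assms by (simp add: rng_assoc)
    finally show ?thesis by simp
  qed
  then show ?thesis
    using assms by (simp add: translate_def act_times)
qed

lemma translate_zero [simp]: "g \<in> carrier G \<Longrightarrow> translate g \<zero>\<^bsub>A\<^esub> = \<zero>\<^bsub>A\<^esub>"
  using translate_plus[of g "\<zero>\<^bsub>A\<^esub>" "\<zero>\<^bsub>A\<^esub>"] translate_carrier[of g "\<zero>\<^bsub>A\<^esub>"] by simp

lemma translate_object: "y \<in> objects G \<Longrightarrow> a \<in> carrier A \<Longrightarrow> translate y a = a \<cdot> idem y"
  by (simp add: translate_def act_object)

lemma translate_finsum:
  assumes "finite T" "g \<in> carrier G" "f \<in> T \<rightarrow> carrier A"
  shows "translate g (finsum A f T) = finsum A (\<lambda>i. translate g (f i)) T"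
  using assms
proof (induction T)
  case (insert i T)
  then have "f i \<in> carrier A" "f \<in> T \<rightarrow> carrier A" "(\<lambda>i. translate g (f i)) \<in> T \<rightarrow> carrier A"
    by (auto simp: Pi_iff)
  with insert show ?case by (simp add: translate_plus)
qed simp

text \<open>One half of \<open>\<beta>\<^sub>g (1\<^bsub>g\<inverse>\<^esub> 1\<^sub>h) = 1\<^sub>g 1\<^bsub>gh\<^esub>\<close>; the other half is the same statement for \<open>g\<inverse>\<close>
  and \<open>gh\<close>.\<close>

lemma translate_idem_B:
  assumes "g \<in> carrier G" "h \<in> carrier G" "src G g = tgt G h"
  shows "translate g (idem h) \<in> B (g \<star> h)"
proof -
  \<comment> \<open>\<open>?u\<close> lies in both \<open>B (g\<^sup>-)\<close> and
    \<open>B h\<close>. Its pullback \<open>?f\<close> along \<open>h\<close> is therefore a point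
    where \<beta>_g \<beta>_h is defined, and the extension property puts the value there into
    \<open>B (g \<star> h)\<close>.\<close>
  let ?u = "idem (g\<^sup>-) \<cdot> idem h" and ?f = "act (h\<^sup>-) (idem (g\<^sup>-) \<cdot> idem h)"
  have "?f \<in> B (h\<^sup>-)" "act h ?f = ?u"
    using assms act_B[of "h\<^sup>-" ?u] by (auto simp: act_ginv)
  then have "?f \<in> B ((g \<star> h)\<^sup>-)" "act (g \<star> h) ?f = act g ?u"
    using act_act[of g h ?f] assms by simp_all
  then show ?thesis
    using act_B[of "g \<star> h" ?f] assms idem_commute[of "g\<^sup>-" "idem h"] by (simp add: translate_def)
qed

lemma translate_idem:
  assumes "g \<in> carrier G" "h \<in> carrier G" "src G g = tgt G h"
  shows "translate g (idem h) = idem g \<cdot> idem (g \<star> h)"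
proof -
  let ?u = "idem g \<cdot> idem (g \<star> h)"
  let ?v = "act (g\<^sup>-) ?u"
  have u: "?u \<in> B g" "?u \<in> B (g \<star> h)" "?u \<in> carrier A"
    using assms by auto
  have v: "?v \<in> B (g\<^sup>-)" "act g ?v = ?u"
    using u assms act_B[of "g\<^sup>-" ?u] by (auto simp: act_ginv)
  \<comment> \<open>The preceding lemma for \<open>g\<^sup>-\<close> and \<open>g \<star> h\<close>
    applies, since their product is \<open>h\<close>. Hence \<open>?v\<close> is unchanged by
    \<open>idem h\<close>, and applying \<open>translate g\<close> shows that \<open>?u\<close> is
    unchanged by \<open>translate g (idem h)\<close>.\<close>
  have "?v \<in> B h"
    using translate_idem_B[of "g\<^sup>-" "g \<star> h"] assms idem_commute[of g "idem (g \<star> h)"]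
    by (simp add: translate_def)
  then have "?v \<cdot> idem h = ?v"
    using assms by simp
  then have "?u = translate g ?v \<cdot> translate g (idem h)"
    using translate_times[of g ?v "idem h"] translate_eq[of g ?v] v assms B_carrier[of h ?v]
      \<open>?v \<in> B h\<close> by simp
  also have "\<dots> = ?u \<cdot> translate g (idem h)"
    using v assms by (simp add: translate_eq)
  \<comment> \<open>Conversely, \<open>translate g (idem h)\<close> lies in \<open>B g\<close> and
    in \<open>B (g \<star> h)\<close>, so \<open>?u\<close> acts on it as an identity.\<close>
  also have "\<dots> = idem g \<cdot> (idem (g \<star> h) \<cdot> translate g (idem h))"
    using assms by (simp add: rng_assoc)
  also have "\<dots> = translate g (idem h)"
    using assms translate_idem_B[of g h] by simp
  finally show ?thesis by simp
qed

text \<open>\<open>?f\<close> is the preimage under \<beta>_h of 1_(g^-1) 1_h, so \<beta>_g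
  \<beta>_h applies to \<open>a \<cdot> ?f\<close>. Evaluated stepwise this gives the left side,
  because the factor 1_(g^-1) produced by \<open>?f\<close> is the one \<open>translate g\<close>
  inserts anyway. Evaluated through \<beta>_(gh), multiplicativity gives
  \<open>translate (g \<star> h) a\<close> times 1_g 1_(gh).\<close>

lemma translate_translate:
  assumes gh: "g \<in> carrier G" "h \<in> carrier G" "src G g = tgt G h" and a: "a \<in> carrier A"
  shows "translate g (translate h a) = idem g \<cdot> translate (g \<star> h) a"
proof -
  let ?u = "idem (g\<^sup>-) \<cdot> idem h" and ?f = "act (h\<^sup>-) (idem (g\<^sup>-) \<cdot> idem h)"
  have f: "?f \<in> B (h\<^sup>-)" "act h ?f = ?u"
    using gh act_B[of "h\<^sup>-" ?u] by (auto simp: act_ginv)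
  have f': "?f \<in> B ((g \<star> h)\<^sup>-)" "act (g \<star> h) ?f = act g ?u"
    using act_act[of g h ?f] f gh by simp_all
  have fc: "?f \<in> carrier A" using f(1) gh B_carrier[of "h\<^sup>-" ?f] by simp
  have u: "act g ?u = idem g \<cdot> idem (g \<star> h)"
    using translate_idem[OF gh] gh idem_commute[of "g\<^sup>-" "idem h"] by (simp add: translate_def)
  have af: "a \<cdot> ?f \<in> B (h\<^sup>-)" using f a gh by simp
  have "act h (a \<cdot> ?f) = translate h a \<cdot> ?u"
    using translate_times[of h a ?f] gh a f fc af by (simp add: translate_eq)
  also have "\<dots> = (translate h a \<cdot> idem h) \<cdot> idem (g\<^sup>-)"
    using gh a idem_commute[of "g\<^sup>-" "idem h"] by (subst rng_assoc) auto
  also have "\<dots> = translate h a \<cdot> idem (g\<^sup>-)"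
    using gh a by simp
  finally have h_af: "act h (a \<cdot> ?f) = translate h a \<cdot> idem (g\<^sup>-)" .
  then have "act (g \<star> h) (a \<cdot> ?f) = translate g (translate h a)"
    using act_act(2)[of g h "a \<cdot> ?f"] af gh a by (simp add: translate_def[of g])
  moreover have "act (g \<star> h) (a \<cdot> ?f) = translate (g \<star> h) a \<cdot> (idem g \<cdot> idem (g \<star> h))"
    using translate_times[of "g \<star> h" a ?f] gh a f' fc u by (simp add: translate_eq)
  moreover have "\<dots> = idem g \<cdot> translate (g \<star> h) a"
    using gh a idem_commute[of g "translate (g \<star> h) a"] idem_commute[of g "idem (g \<star> h)"]
    by (simp flip: rng_assoc)
  ultimately show ?thesis by simp
qed

lemma idem_tgt:
  assumes "g \<in> carrier G"
  shows "idem (tgt G g) \<cdot> idem g = idem g"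
proof -
  have "B g \<subseteq> B (tgt G g)"
    using partial_action assms rng.rng_idealD(1)[OF rng_rng_ideal[OF B_ideal[of "tgt G g"]]]
    by (fastforce simp: partial_action_def)
  then show ?thesis using assms by (intro idem_times) auto
qed

section \<open>The identity of \<open>A\<close>\<close>

lemma finite_objects: "finite (objects G)"
  unfolding objects_def by (intro finite_imageI finite_arrows)

text \<open>Placing \<open>a\<close> at \<open>y\<close> or at \<open>z\<close> gives two
  decompositions of the same element; by uniqueness they agree at \<open>y\<close>.\<close>

lemma B_object_disjoint:
  assumes y: "y \<in> objects G" and z: "z \<in> objects G" and "y \<noteq> z" and a: "a \<in> B y" "a \<in> B z"
  shows "a = \<zero>\<^bsub>A\<^esub>"
proof -
  let ?c = "\<lambda>w. \<lambda>v\<in>objects G. if w = v then a else \<zero>\<^bsub>A\<^esub>"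
  have ac: "a \<in> carrier A" using a(1) y B_carrier[of y] by simp
  have eq: "finsum A (?c w) (objects G) = a" if w: "w \<in> objects G" for w
  proof -
    have "finsum A (?c w) (objects G) = finsum A (\<lambda>v. if w = v then a else \<zero>\<^bsub>A\<^esub>) (objects G)"
      using ac by (intro finsum_cong') auto
    also have "\<dots> = a"
      using finsum_singleton[OF w finite_objects, of "\<lambda>v. a"] ac by simp
    finally show ?thesis .
  qed
  have mem: "?c w \<in> PiE (objects G) B" if "w \<in> {y, z}" for w
    using that a y z by auto
  have "\<exists>!c. c \<in> PiE (objects G) B \<and> a = finsum A c (objects G)"
    using direct_sum ac by (auto simp: internal_direct_sum_def)
  then have "?c y = ?c z"
    using mem[of y] mem[of z] eq[OF y] eq[OF z] by auto
  then have "?c y y = ?c z y" by (rule fun_cong)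
  then show ?thesis using y \<open>y \<noteq> z\<close> by simp
qed

definition unity :: 'a where
  "unity = finsum A idem (objects G)"

lemma unity_closed [simp]: "unity \<in> carrier A"
  unfolding unity_def by (intro finsum_closed) auto

text \<open>Each \<open>idem y\<close> projects onto the component at \<open>y\<close>: its product
  with a component at another object lies in two different summands and so vanishes.\<close>

lemma unity_times:
  assumes a: "a \<in> carrier A" shows "unity \<cdot> a = a"
proof -
  obtain c where c: "c \<in> PiE (objects G) B" and ac: "a = finsum A c (objects G)"
    using direct_sum a by (auto simp: internal_direct_sum_def)
  have cB: "c y \<in> B y" "c y \<in> carrier A" if "y \<in> objects G" for y
    using c that B_carrier[of y "c y"] by (auto simp: PiE_def Pi_def)
  have "idem y \<cdot> a = c y" if y: "y \<in> objects G" for y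
  proof -
    have "idem y \<cdot> a = finsum A (\<lambda>z. idem y \<cdot> c z) (objects G)"
      unfolding ac using y cB by (intro rng_finsum_rdistr finite_objects) auto
    also have "\<dots> = finsum A (\<lambda>z. if y = z then c z else \<zero>\<^bsub>A\<^esub>) (objects G)"
    proof (rule finsum_cong')
      fix z assume z: "z \<in> objects G"
      show "idem y \<cdot> c z = (if y = z then c z else \<zero>\<^bsub>A\<^esub>)"
        using B_object_disjoint[OF y z, of "idem y \<cdot> c z"] y z cB by auto
    qed (use cB in auto)
    also have "\<dots> = c y"
      using cB by (intro finsum_singleton[OF y finite_objects]) auto
    finally show ?thesis .
  qed
  then have "finsum A (\<lambda>y. idem y \<cdot> a) (objects G) = a"
    using cB unfolding ac by (intro finsum_cong') auto
  then show ?thesis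
    unfolding unity_def using a by (subst rng_finsum_ldistr[OF finite_objects]) auto
qed

lemma times_unity:
  assumes a: "a \<in> carrier A" shows "a \<cdot> unity = a"
proof -
  have "a \<cdot> unity = finsum A (\<lambda>y. a \<cdot> idem y) (objects G)"
    unfolding unity_def using a by (intro rng_finsum_rdistr finite_objects) auto
  also have "\<dots> = finsum A (\<lambda>y. idem y \<cdot> a) (objects G)"
    using a by (intro finsum_cong') (auto intro: idem_commute)
  also have "\<dots> = unity \<cdot> a"
    unfolding unity_def using a by (intro rng_finsum_ldistr[symmetric] finite_objects) auto
  finally show ?thesis using a by (simp add: unity_times)
qed

lemma identity_of_unity: "identity_of A = unity"
  by (rule identity_of_eq) (simp add: is_identity_def unity_times times_unity)

lemma ring_with_one: "ring (with_one A)"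
proof (rule ringI)
  have "add_monoid (with_one A) = add_monoid A" by (simp add: with_one_def)
  then show "abelian_group (with_one A)"
    using a_comm_group by (simp add: abelian_group_def abelian_group_axioms_def
        abelian_monoid_def comm_group_def)
  show "monoid (with_one A)"
    by unfold_locales (auto simp: with_one_def identity_of_unity unity_times times_unity rng_assoc)
qed (auto simp: with_one_def rng_l_distr rng_r_distr)

end


section \<open>Tensor squares\<close>

locale balanced_tensors = abelian_monoid S for S :: "('s, 'n) ring_scheme" (structure) +
  fixes R :: "('r, 'm) ring_scheme" and \<phi> :: "'r \<Rightarrow> 's"
  assumes embed_closed: "r \<in> carrier R \<Longrightarrow> \<phi> r \<in> carrier S"
    and times_closed: "\<lbrakk>a \<in> carrier S; b \<in> carrier S\<rbrakk> \<Longrightarrow> a \<otimes> b \<in> carrier S"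
begin

abbreviation "F \<equiv> free_Abelian_group (carrier S \<times> carrier S)"
abbreviation "K \<equiv> tensor_kernel R S \<phi>"
abbreviation "pt \<equiv> pure_tensor R S \<phi>"

sublocale F: comm_group F by (rule abelian_free_Abelian_group)

lemma frag_of_F: "a \<in> carrier S \<Longrightarrow> b \<in> carrier S \<Longrightarrow> frag_of (a, b) \<in> carrier F"
  by simp

lemma minus_F: "u \<in> carrier F \<Longrightarrow> v \<in> carrier F \<Longrightarrow> u - v \<in> carrier F"
  using keys_diff[of u v] by auto

lemma tensor_relations_F: "tensor_relations R S \<phi> \<subseteq> carrier F"
  unfolding tensor_relations_def
  by (intro Un_least subsetI; clarify; intro minus_F frag_of_F a_closed embed_closed times_closed)

lemma K_subgroup: "subgroup K F"
  unfolding tensor_kernel_def by (intro F.generate_is_subgroup tensor_relations_F)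

sublocale K: normal K F
  by (intro F.subgroup_imp_normal K_subgroup)

sublocale T: comm_group "tensor_square R S \<phi>"
  unfolding tensor_square_def by (intro F.abelian_FactGroup K_subgroup)

lemma coset_eqI:
  assumes "u \<in> carrier F" "v \<in> carrier F" "u - v \<in> tensor_relations R S \<phi>"
  shows "K #>\<^bsub>F\<^esub> u = K #>\<^bsub>F\<^esub> v"
proof -
  have "u - v \<in> K"
    unfolding tensor_kernel_def by (intro generate.incl assms)
  then have "u \<in> K #>\<^bsub>F\<^esub> v"
    by (force simp: r_coset_def)
  then show ?thesis
    using F.repr_independence[OF _ assms(2) K_subgroup] by simp
qed

lemma pt_closed [simp]: "a \<in> carrier S \<Longrightarrow> b \<in> carrier S \<Longrightarrow> pt a b \<in> carrier (tensor_square R S \<phi>)"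
  unfolding tensor_square_def carrier_FactGroup pure_tensor_def by (intro imageI frag_of_F)

lemma times_pt:
  assumes "a \<in> carrier S" "b \<in> carrier S" "a' \<in> carrier S" "b' \<in> carrier S"
  shows "pt a b \<otimes>\<^bsub>tensor_square R S \<phi>\<^esub> pt a' b' = K #>\<^bsub>F\<^esub> (frag_of (a, b) + frag_of (a', b'))"
  using K.rcos_sum[OF frag_of_F[OF assms(1,2)] frag_of_F[OF assms(3,4)]]
  by (simp add: tensor_square_def pure_tensor_def)

lemma plus_F: "u \<in> carrier F \<Longrightarrow> v \<in> carrier F \<Longrightarrow> u + v \<in> carrier F"
  using F.m_closed[of u v] by simp

lemma pt_plus_left:
  assumes "a \<in> carrier S" "a' \<in> carrier S" "b \<in> carrier S"
  shows "pt (a \<oplus> a') b = pt a b \<otimes>\<^bsub>tensor_square R S \<phi>\<^esub> pt a' b"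
proof -
  have "frag_of (a \<oplus> a', b) - (frag_of (a, b) + frag_of (a', b)) \<in> tensor_relations R S \<phi>"
    unfolding tensor_relations_def diff_diff_eq[symmetric] using assms by blast
  then have "K #>\<^bsub>F\<^esub> frag_of (a \<oplus> a', b) = K #>\<^bsub>F\<^esub> (frag_of (a, b) + frag_of (a', b))"
    using assms by (intro coset_eqI plus_F frag_of_F) auto
  then show ?thesis
    unfolding times_pt[OF assms(1,3,2,3)] by (simp add: pure_tensor_def)
qed

lemma pt_plus_right:
  assumes "a \<in> carrier S" "b \<in> carrier S" "b' \<in> carrier S"
  shows "pt a (b \<oplus> b') = pt a b \<otimes>\<^bsub>tensor_square R S \<phi>\<^esub> pt a b'"
proof -
  have "frag_of (a, b \<oplus> b') - (frag_of (a, b) + frag_of (a, b')) \<in> tensor_relations R S \<phi>"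
    unfolding tensor_relations_def diff_diff_eq[symmetric] using assms by blast
  then have "K #>\<^bsub>F\<^esub> frag_of (a, b \<oplus> b') = K #>\<^bsub>F\<^esub> (frag_of (a, b) + frag_of (a, b'))"
    using assms by (intro coset_eqI plus_F frag_of_F) auto
  then show ?thesis
    unfolding times_pt[OF assms(1,2,1,3)] by (simp add: pure_tensor_def)
qed

text \<open>Additivity at zero plus zero makes this tensor idempotent, and the only idempotent of a
  group is its neutral element, here written multiplicatively.\<close>

lemma pt_zero_left [simp]:
  assumes "b \<in> carrier S" shows "pt \<zero> b = \<one>\<^bsub>tensor_square R S \<phi>\<^esub>"
  using pt_plus_left[of \<zero> \<zero> b] assms T.l_cancel_one'[of "pt \<zero> b" "pt \<zero> b"] by simp

lemma pt_zero_right [simp]: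
  assumes "a \<in> carrier S" shows "pt a \<zero> = \<one>\<^bsub>tensor_square R S \<phi>\<^esub>"
  using pt_plus_right[of a \<zero> \<zero>] assms T.l_cancel_one'[of "pt a \<zero>" "pt a \<zero>"] by simp

lemma pt_balanced:
  assumes "a \<in> carrier S" "b \<in> carrier S" "r \<in> carrier R"
  shows "pt (a \<otimes> \<phi> r) b = pt a (\<phi> r \<otimes> b)"
  unfolding pure_tensor_def
proof (rule coset_eqI)
  show "frag_of (a \<otimes> \<phi> r, b) - frag_of (a, \<phi> r \<otimes> b) \<in> tensor_relations R S \<phi>"
    unfolding tensor_relations_def using assms by blast
qed (use assms in \<open>auto intro: embed_closed times_closed\<close>)

end

lemma balanced_tensors_ring_extension:
  "ring_extension R S \<phi> \<Longrightarrow> balanced_tensors S R \<phi>"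
  unfolding ring_extension_def balanced_tensors_def balanced_tensors_axioms_def
  by (auto simp: ring_hom_def ring_def abelian_group_def intro: ring.ring_simprules(5))


section \<open>Frobenius extensions\<close>

text \<open>Allows the Frobenius tensor to be indexed by any finite set, such as the arrows of a
  groupoid, by transport along an enumeration of that set.\<close>

lemma frobenius_extensionI:
  assumes ext: "ring_extension R S \<phi>" and X: "finite X"
    and p: "p \<in> X \<rightarrow> carrier S" and q: "q \<in> X \<rightarrow> carrier S"
    and \<epsilon>: "bimodule_map R S \<phi> \<epsilon>"
    and casimir: "\<And>s. s \<in> carrier S \<Longrightarrow>
      finprod (tensor_square R S \<phi>) (\<lambda>i. pure_tensor R S \<phi> (s \<otimes>\<^bsub>S\<^esub> p i) (q i)) X =
      finprod (tensor_square R S \<phi>) (\<lambda>i. pure_tensor R S \<phi> (p i) (q i \<otimes>\<^bsub>S\<^esub> s)) X"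
    and left: "finsum S (\<lambda>i. \<phi> (\<epsilon> (p i)) \<otimes>\<^bsub>S\<^esub> q i) X = \<one>\<^bsub>S\<^esub>"
    and right: "finsum S (\<lambda>i. p i \<otimes>\<^bsub>S\<^esub> \<phi> (\<epsilon> (q i))) X = \<one>\<^bsub>S\<^esub>"
  shows "frobenius_extension R S \<phi>"
proof -
  interpret S: ring S using ext by (simp add: ring_extension_def)
  interpret TS: balanced_tensors S R \<phi> by (rule balanced_tensors_ring_extension[OF ext])
  have \<epsilon>\<phi>: "\<phi> (\<epsilon> s) \<in> carrier S" if "s \<in> carrier S" for s
    using \<epsilon> that by (auto simp: bimodule_map_def intro!: TS.embed_closed)
  obtain f :: "nat \<Rightarrow> _" where f: "bij_betw f {..<card X} X"
    using ex_bij_betw_nat_finite[OF X] by (auto simp: atLeast0LessThan)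
  have X_eq: "X = f ` {..<card X}" and inj: "inj_on f {..<card X}"
    using f by (auto simp: bij_betw_def)
  have fX: "p (f i) \<in> carrier S" "q (f i) \<in> carrier S" if "i < card X" for i
    using that p q f by (auto dest!: bij_betwE)
  have prod: "finprod (tensor_square R S \<phi>) h X = finprod (tensor_square R S \<phi>) (\<lambda>i. h (f i)) {..<card X}"
    if "h \<in> X \<rightarrow> carrier (tensor_square R S \<phi>)" for h
    using TS.T.finprod_reindex[OF _ inj, of h] that X_eq by simp
  have sum: "finsum S h X = finsum S (\<lambda>i. h (f i)) {..<card X}" if "h \<in> X \<rightarrow> carrier S" for h
    using S.finsum_reindex[OF _ inj, of h] that X_eq by simp
  show ?thesis
    unfolding frobenius_extension_def
  proof (rule conjI[OF ext], rule exI[of _ "card X"], rule exI[of _ "\<lambda>i. p (f i)"],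
      rule exI[of _ "\<lambda>i. q (f i)"], rule exI[of _ \<epsilon>], intro conjI \<epsilon> ballI allI impI)
    fix s assume s: "s \<in> carrier S"
    show "finprod (tensor_square R S \<phi>) (\<lambda>i. pure_tensor R S \<phi> (s \<otimes>\<^bsub>S\<^esub> p (f i)) (q (f i))) {..<card X} =
      finprod (tensor_square R S \<phi>) (\<lambda>i. pure_tensor R S \<phi> (p (f i)) (q (f i) \<otimes>\<^bsub>S\<^esub> s)) {..<card X}"
      using casimir[OF s] s p q by (subst (asm) (1 2) prod) (auto simp: Pi_iff)
  next
    show "finsum S (\<lambda>i. \<phi> (\<epsilon> (p (f i))) \<otimes>\<^bsub>S\<^esub> q (f i)) {..<card X} = \<one>\<^bsub>S\<^esub>"
      using left p q by (subst (asm) sum) (auto simp: Pi_iff \<epsilon>\<phi>)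
  next
    show "finsum S (\<lambda>i. p (f i) \<otimes>\<^bsub>S\<^esub> \<phi> (\<epsilon> (q (f i)))) {..<card X} = \<one>\<^bsub>S\<^esub>"
      using right p q by (subst (asm) sum) (auto simp: Pi_iff \<epsilon>\<phi>)
  qed (use fX in auto)
qed

text \<open>Needed because \<open>skew_embedding\<close> and \<open>delta\<close> at
  \<open>x\<close> are different functions that are only known to agree on \<open>B x\<close>.
  Relations, tensors and bimodule maps see an embedding only on the carrier.\<close>

lemma frobenius_extension_cong:
  assumes "frobenius_extension R S \<phi>" and eq: "\<And>r. r \<in> carrier R \<Longrightarrow> \<phi> r = \<psi> r"
  shows "frobenius_extension R S \<psi>"
proof -
  have ext: "ring_extension R S \<phi>" using assms(1) by (simp add: frobenius_extension_def)
  then have ext': "ring_extension R S \<psi>"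
    using eq ring.ring_simprules(1,5,6)[of R]
    by (auto simp: ring_extension_def ring_hom_def Pi_iff inj_on_def)
  have "tensor_relations R S \<psi> = tensor_relations R S \<phi>"
    unfolding tensor_relations_def using eq by (intro arg_cong2[of _ _ _ _ "(\<union>)"] refl) force
  then have T: "tensor_square R S \<psi> = tensor_square R S \<phi>" "pure_tensor R S \<psi> = pure_tensor R S \<phi>"
    by (simp_all add: tensor_square_def pure_tensor_def tensor_kernel_def fun_eq_iff)
  have bim: "bimodule_map R S \<psi> \<epsilon> \<longleftrightarrow> bimodule_map R S \<phi> \<epsilon>" for \<epsilon>
    using eq by (simp add: bimodule_map_def)
  obtain n :: nat and p q \<epsilon> where *: "\<And>i. i < n \<Longrightarrow> p i \<in> carrier S" "\<And>i. i < n \<Longrightarrow> q i \<in> carrier S"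
      "bimodule_map R S \<phi> \<epsilon>"
      "\<forall>s\<in>carrier S.
           finprod (tensor_square R S \<phi>) (\<lambda>i. pure_tensor R S \<phi> (s \<otimes>\<^bsub>S\<^esub> p i) (q i)) {..<n} =
           finprod (tensor_square R S \<phi>) (\<lambda>i. pure_tensor R S \<phi> (p i) (q i \<otimes>\<^bsub>S\<^esub> s)) {..<n}"
      "finsum S (\<lambda>i. \<phi> (\<epsilon> (p i)) \<otimes>\<^bsub>S\<^esub> q i) {..<n} = \<one>\<^bsub>S\<^esub>"
      "finsum S (\<lambda>i. p i \<otimes>\<^bsub>S\<^esub> \<phi> (\<epsilon> (q i))) {..<n} = \<one>\<^bsub>S\<^esub>"
    using assms(1) unfolding frobenius_extension_def by blast
  interpret S: ring S using ext by (simp add: ring_extension_def)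
  interpret TS: balanced_tensors S R \<phi> by (rule balanced_tensors_ring_extension[OF ext])
  have \<epsilon>: "\<epsilon> s \<in> carrier R" "\<psi> (\<epsilon> s) = \<phi> (\<epsilon> s)" if "s \<in> carrier S" for s
  proof -
    show "\<epsilon> s \<in> carrier R"
      using *(3) that by (auto simp: bimodule_map_def)
    then show "\<psi> (\<epsilon> s) = \<phi> (\<epsilon> s)"
      by (simp add: eq)
  qed
  show ?thesis
  proof (rule frobenius_extensionI[OF ext'])
    show "finsum S (\<lambda>i. \<psi> (\<epsilon> (p i)) \<otimes>\<^bsub>S\<^esub> q i) {..<n} = \<one>\<^bsub>S\<^esub>"
      unfolding *(5)[symmetric] using *(1,2) by (intro S.finsum_cong') (auto simp: \<epsilon> TS.embed_closed)
    show "finsum S (\<lambda>i. p i \<otimes>\<^bsub>S\<^esub> \<psi> (\<epsilon> (q i))) {..<n} = \<one>\<^bsub>S\<^esub>"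
      unfolding *(6)[symmetric] using *(1,2) by (intro S.finsum_cong') (auto simp: \<epsilon> TS.embed_closed)
  qed (use * in \<open>auto simp: T bim\<close>)
qed


section \<open>Partial skew groupoid rings\<close>

context unital_partial_action
begin

section \<open>Coefficients of products in the skew ring\<close>

abbreviation S where "S \<equiv> skew_ring G A B \<beta>"

text \<open>A factorization of \<open>k\<close> into two arrows is determined by its first factor,
  which may be any arrow with the target of \<open>k\<close>. Sums over pairs thus become sums over
  these sets.\<close>

definition costar :: "'g \<Rightarrow> 'g set" where
  "costar y = {g \<in> carrier G. tgt G g = y}"

lemma finite_costar [simp]: "finite (costar y)"
  using finite_arrows by (simp add: costar_def)

lemma costarD: "g \<in> costar y \<Longrightarrow> g \<in> carrier G" "g \<in> costar y \<Longrightarrow> tgt G g = y"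
  by (simp_all add: costar_def)

lemma carrier_S: "carrier S = PiE (carrier G) B"
  and zero_S: "\<zero>\<^bsub>S\<^esub> = (\<lambda>g\<in>carrier G. \<zero>\<^bsub>A\<^esub>)"
  and one_S: "\<one>\<^bsub>S\<^esub> = (\<lambda>g\<in>carrier G. if g \<in> objects G then idem g else \<zero>\<^bsub>A\<^esub>)"
  and plus_S: "a \<oplus>\<^bsub>S\<^esub> b = (\<lambda>g\<in>carrier G. a g \<^bold>+ b g)"
  by (simp_all add: skew_ring_def)

lemma S_apply:
  assumes "s \<in> carrier S" "g \<in> carrier G"
  shows "s g \<in> B g" "s g \<in> carrier A"
  using assms B_carrier[of g "s g"] by (auto simp: carrier_S)

lemma S_eqI:
  assumes "a \<in> carrier S" "b \<in> carrier S" "\<And>k. k \<in> carrier G \<Longrightarrow> a k = b k"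
  shows "a = b"
  using assms by (auto simp: carrier_S intro: PiE_ext)

text \<open>The change of variables behind both associativity and the commutation of the Frobenius
  tensor with monomials; the inverse bijection is multiplication by
  \<open>h\<^sup>-\<close>.\<close>

lemma costar_shift:
  assumes "h \<in> carrier G"
  shows "costar (tgt G h) = (\<lambda>g. h \<star> g) ` costar (src G h)" "inj_on (\<lambda>g. h \<star> g) (costar (src G h))"
proof -
  show "inj_on (\<lambda>g. h \<star> g) (costar (src G h))"
    using assms by (intro inj_on_inverseI[of _ "\<lambda>k. h\<^sup>- \<star> k"]) (auto simp: costar_def)
  have "k = h \<star> (h\<^sup>- \<star> k)" "h\<^sup>- \<star> k \<in> costar (src G h)" if "k \<in> costar (tgt G h)" for k
    using assms that by (auto simp: costar_def)
  moreover have "h \<star> g \<in> costar (tgt G h)" if "g \<in> costar (src G h)" for g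
    using assms that by (auto simp: costar_def)
  ultimately show "costar (tgt G h) = (\<lambda>g. h \<star> g) ` costar (src G h)"
    by blast
qed

text \<open>A coefficient at \<open>h\<close> is a multiple of \<open>idem h\<close>, so its
  translate by \<open>g\<close> is a multiple of \<open>translate g (idem h)\<close>, which lies in
  the ideal of the product arrow.\<close>

lemma mult_term_B:
  assumes "s \<in> carrier S" "t \<in> carrier S" "k \<in> carrier G" "g \<in> costar (tgt G k)"
  shows "s g \<cdot> translate g (t (g\<^sup>- \<star> k)) \<in> B k"
proof -
  have g: "g \<in> carrier G" "tgt G g = tgt G k"
    using assms(4) by (auto simp: costar_def)
  let ?h = "g\<^sup>- \<star> k"
  have h: "?h \<in> carrier G" "g \<star> ?h = k" using g assms by auto
  have s: "s g \<in> B g" "s g \<in> carrier A" and t: "t ?h \<in> B ?h" "t ?h \<in> carrier A"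
    using S_apply assms g h by auto
  have "translate g (t ?h) = translate g (idem ?h) \<cdot> translate g (t ?h)"
    using translate_times[of g "idem ?h" "t ?h"] g h t by simp
  also have "translate g (idem ?h) \<in> B k"
    using translate_idem_B[of g ?h] g h assms by simp
  then have "translate g (idem ?h) \<cdot> translate g (t ?h) \<in> B k"
    using g t assms by simp
  finally show ?thesis
    using s assms by simp
qed

lemma mult_apply:
  assumes "s \<in> carrier S" "t \<in> carrier S" "k \<in> carrier G"
  shows "(s \<otimes>\<^bsub>S\<^esub> t) k = finsum A (\<lambda>g. s g \<cdot> translate g (t (g\<^sup>- \<star> k))) (costar (tgt G k))"
proof -
  let ?P = "{(g, h). g \<in> carrier G \<and> h \<in> carrier G \<and> src G g = tgt G h \<and> g \<star> h = k}"
  have P: "?P = (\<lambda>g. (g, g\<^sup>- \<star> k)) ` costar (tgt G k)"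
    using assms(3) by (auto simp: costar_def image_iff)
  have "(s \<otimes>\<^bsub>S\<^esub> t) k = finsum A (\<lambda>(g, h). s g \<cdot> translate g (t h)) ?P"
    using assms(3) by (simp add: skew_ring_def translate_def)
  also have "\<dots> = finsum A (\<lambda>g. s g \<cdot> translate g (t (g\<^sup>- \<star> k))) (costar (tgt G k))"
    unfolding P using mult_term_B[OF assms] B_carrier[OF assms(3)]
    by (subst finsum_reindex) (auto simp: inj_on_def)
  finally show ?thesis .
qed

text \<open>For products with a monomial or with an embedded element of \<open>A\<close>, where at
  most one factorization contributes. The disjunction lets either factor be responsible for the
  vanishing.\<close>

lemma mult_apply_single:
  assumes "s \<in> carrier S" "t \<in> carrier S" "k \<in> carrier G" "h \<in> carrier G" "tgt G h = tgt G k"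
    and "\<And>g. \<lbrakk>g \<in> carrier G; tgt G g = tgt G k; g \<noteq> h\<rbrakk> \<Longrightarrow> s g = \<zero>\<^bsub>A\<^esub> \<or> t (g\<^sup>- \<star> k) = \<zero>\<^bsub>A\<^esub>"
  shows "(s \<otimes>\<^bsub>S\<^esub> t) k = s h \<cdot> translate h (t (h\<^sup>- \<star> k))"
  unfolding mult_apply[OF assms(1-3)]
proof (rule finsum_single)
  show h: "h \<in> costar (tgt G k)" using assms by (simp add: costar_def)
  show "s h \<cdot> translate h (t (h\<^sup>- \<star> k)) \<in> carrier A"
    using mult_term_B[OF assms(1-3) h] B_carrier[OF assms(3)] by simp
  fix g assume g: "g \<in> costar (tgt G k)" "g \<noteq> h"
  then have "g \<in> carrier G" "tgt G g = tgt G k" by (auto simp: costar_def)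
  then have "s g = \<zero>\<^bsub>A\<^esub> \<or> t (g\<^sup>- \<star> k) = \<zero>\<^bsub>A\<^esub>"
    and "g \<in> carrier G" "s g \<in> carrier A" "t (g\<^sup>- \<star> k) \<in> carrier A"
    using assms(6)[of g] g S_apply[of s g] S_apply[of t "g\<^sup>- \<star> k"] assms by simp_all
  then show "s g \<cdot> translate g (t (g\<^sup>- \<star> k)) = \<zero>\<^bsub>A\<^esub>"
    by (elim disjE) simp_all
qed simp

section \<open>Ring axioms\<close>

lemma zero_S_closed: "\<zero>\<^bsub>S\<^esub> \<in> carrier S"
  by (auto simp: carrier_S zero_S)

lemma one_S_closed: "\<one>\<^bsub>S\<^esub> \<in> carrier S"
  by (auto simp: carrier_S one_S)

lemma plus_S_closed: "s \<in> carrier S \<Longrightarrow> t \<in> carrier S \<Longrightarrow> s \<oplus>\<^bsub>S\<^esub> t \<in> carrier S"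
  by (auto simp: carrier_S plus_S PiE_iff)

lemma mult_S_closed:
  assumes "s \<in> carrier S" "t \<in> carrier S" shows "s \<otimes>\<^bsub>S\<^esub> t \<in> carrier S"
proof -
  have "(s \<otimes>\<^bsub>S\<^esub> t) k \<in> B k" if k: "k \<in> carrier G" for k
    unfolding mult_apply[OF assms k] using k B_carrier[OF k] mult_term_B[OF assms k]
    by (intro finsum_mem) auto
  moreover have "s \<otimes>\<^bsub>S\<^esub> t \<in> extensional (carrier G)"
    by (simp add: skew_ring_def)
  ultimately show ?thesis by (auto simp: carrier_S PiE_iff)
qed

lemma abelian_group_S: "abelian_group S"
proof (rule abelian_groupI)
  fix s assume s: "s \<in> carrier S"
  define t where "t = (\<lambda>g\<in>carrier G. \<ominus>\<^bsub>A\<^esub> s g)"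
  have "t \<in> carrier S"
    using S_apply(1)[OF s] by (auto simp: carrier_S t_def)
  moreover have "t \<oplus>\<^bsub>S\<^esub> s = \<zero>\<^bsub>S\<^esub>"
    using S_apply[OF s] by (auto simp: plus_S zero_S t_def l_neg intro!: restrict_ext)
  ultimately show "\<exists>t\<in>carrier S. t \<oplus>\<^bsub>S\<^esub> s = \<zero>\<^bsub>S\<^esub>" by blast
next
  fix s assume s: "s \<in> carrier S"
  show "\<zero>\<^bsub>S\<^esub> \<oplus>\<^bsub>S\<^esub> s = s"
    using s by (intro S_eqI plus_S_closed zero_S_closed) (auto simp: plus_S zero_S S_apply)
next
  fix s t u assume stu: "s \<in> carrier S" "t \<in> carrier S" "u \<in> carrier S"
  then show "s \<oplus>\<^bsub>S\<^esub> t \<oplus>\<^bsub>S\<^esub> u = s \<oplus>\<^bsub>S\<^esub> (t \<oplus>\<^bsub>S\<^esub> u)"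
    by (intro S_eqI plus_S_closed) (auto simp: plus_S S_apply a_assoc)
next
  fix s t assume st: "s \<in> carrier S" "t \<in> carrier S"
  then show "s \<oplus>\<^bsub>S\<^esub> t = t \<oplus>\<^bsub>S\<^esub> s"
    by (intro S_eqI plus_S_closed) (auto simp: plus_S S_apply a_comm)
qed (simp_all add: plus_S_closed zero_S_closed)

lemma S_l_distr:
  assumes "s \<in> carrier S" "t \<in> carrier S" "u \<in> carrier S"
  shows "(s \<oplus>\<^bsub>S\<^esub> t) \<otimes>\<^bsub>S\<^esub> u = s \<otimes>\<^bsub>S\<^esub> u \<oplus>\<^bsub>S\<^esub> t \<otimes>\<^bsub>S\<^esub> u"
proof (rule S_eqI)
  fix k assume k: "k \<in> carrier G"
  have *: "g \<in> carrier G" "s g \<in> carrier A" "t g \<in> carrier A" "translate g (u (g\<^sup>- \<star> k)) \<in> carrier A"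
    if "g \<in> costar (tgt G k)" for g
    using that costarD[OF that] S_apply assms k by auto
  have "((s \<oplus>\<^bsub>S\<^esub> t) \<otimes>\<^bsub>S\<^esub> u) k = finsum A (\<lambda>g. s g \<cdot> translate g (u (g\<^sup>- \<star> k)) \<^bold>+
      t g \<cdot> translate g (u (g\<^sup>- \<star> k))) (costar (tgt G k))"
    unfolding mult_apply[OF plus_S_closed[OF assms(1,2)] assms(3) k]
    using * by (intro finsum_cong') (auto simp: plus_S rng_l_distr)
  also have "\<dots> = (s \<otimes>\<^bsub>S\<^esub> u \<oplus>\<^bsub>S\<^esub> t \<otimes>\<^bsub>S\<^esub> u) k"
    using * k by (simp add: plus_S mult_apply assms finsum_addf Pi_iff)
  finally show "((s \<oplus>\<^bsub>S\<^esub> t) \<otimes>\<^bsub>S\<^esub> u) k = (s \<otimes>\<^bsub>S\<^esub> u \<oplus>\<^bsub>S\<^esub> t \<otimes>\<^bsub>S\<^esub> u) k" .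
qed (intro mult_S_closed plus_S_closed assms)+

lemma S_r_distr:
  assumes "s \<in> carrier S" "t \<in> carrier S" "u \<in> carrier S"
  shows "u \<otimes>\<^bsub>S\<^esub> (s \<oplus>\<^bsub>S\<^esub> t) = u \<otimes>\<^bsub>S\<^esub> s \<oplus>\<^bsub>S\<^esub> u \<otimes>\<^bsub>S\<^esub> t"
proof (rule S_eqI)
  fix k assume k: "k \<in> carrier G"
  have *: "g \<in> carrier G" "tgt G g = tgt G k" "u g \<in> carrier A"
      "s (g\<^sup>- \<star> k) \<in> carrier A" "t (g\<^sup>- \<star> k) \<in> carrier A"
    if "g \<in> costar (tgt G k)" for g
    using that costarD[OF that] S_apply assms k by auto
  have "(u \<otimes>\<^bsub>S\<^esub> (s \<oplus>\<^bsub>S\<^esub> t)) k = finsum A (\<lambda>g. u g \<cdot> translate g (s (g\<^sup>- \<star> k)) \<^bold>+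
      u g \<cdot> translate g (t (g\<^sup>- \<star> k))) (costar (tgt G k))"
    unfolding mult_apply[OF assms(3) plus_S_closed[OF assms(1,2)] k]
    using * k by (intro finsum_cong') (auto simp: plus_S rng_r_distr translate_plus)
  also have "\<dots> = (u \<otimes>\<^bsub>S\<^esub> s \<oplus>\<^bsub>S\<^esub> u \<otimes>\<^bsub>S\<^esub> t) k"
    using * k by (simp add: plus_S mult_apply assms finsum_addf Pi_iff)
  finally show "(u \<otimes>\<^bsub>S\<^esub> (s \<oplus>\<^bsub>S\<^esub> t)) k = (u \<otimes>\<^bsub>S\<^esub> s \<oplus>\<^bsub>S\<^esub> u \<otimes>\<^bsub>S\<^esub> t) k" .
qed (intro mult_S_closed plus_S_closed assms)+

text \<open>The composition rule for translates leaves a factor \<open>idem g\<close>, which the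
  neighbouring \<open>translate g\<close> term in \<open>B g\<close> absorbs.\<close>

lemma S_assoc_term:
  assumes s: "s \<in> carrier S" "t \<in> carrier S" "u \<in> carrier S" and k: "k \<in> carrier G"
    and g: "g \<in> costar (tgt G k)" and m: "m \<in> costar (tgt G k)"
  shows "s g \<cdot> translate g (t (g\<^sup>- \<star> m) \<cdot> translate (g\<^sup>- \<star> m) (u ((g\<^sup>- \<star> m)\<^sup>- \<star> (g\<^sup>- \<star> k))))
    = (s g \<cdot> translate g (t (g\<^sup>- \<star> m))) \<cdot> translate m (u (m\<^sup>- \<star> k))"
proof -
  note gm = costarD[OF g] costarD[OF m]
  let ?u = "u (m\<^sup>- \<star> k)" and ?t = "t (g\<^sup>- \<star> m)"
  have c: "s g \<in> B g" "s g \<in> carrier A" "?t \<in> carrier A" "?u \<in> carrier A"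
    using gm k S_apply s by auto
  have "(g\<^sup>- \<star> m)\<^sup>- \<star> (g\<^sup>- \<star> k) = m\<^sup>- \<star> k"
    using gm k by (simp add: ginv_cmp_distrib cmp_assoc)
  moreover have "translate g (?t \<cdot> translate (g\<^sup>- \<star> m) ?u) = translate g ?t \<cdot> (idem g \<cdot> translate m ?u)"
    using gm k c by (simp add: translate_times translate_translate)
  moreover have "\<dots> = translate g ?t \<cdot> translate m ?u"
    using gm c by (simp flip: rng_assoc)
  ultimately show ?thesis
    using gm c by (simp add: rng_assoc)
qed

lemma S_assoc:
  assumes stu: "s \<in> carrier S" "t \<in> carrier S" "u \<in> carrier S"
  shows "s \<otimes>\<^bsub>S\<^esub> t \<otimes>\<^bsub>S\<^esub> u = s \<otimes>\<^bsub>S\<^esub> (t \<otimes>\<^bsub>S\<^esub> u)"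
proof (rule S_eqI)
  fix k assume k: "k \<in> carrier G"
  let ?C = "costar (tgt G k)"
  \<comment> \<open>A triple factorization of \<open>k\<close> is recorded by its first factor
    \<open>g\<close> and by the product \<open>m\<close> of its first two factors. Both range over
    the same set, so the two bracketings become the two orders of one double sum.\<close>
  let ?f = "\<lambda>g m. (s g \<cdot> translate g (t (g\<^sup>- \<star> m))) \<cdot> translate m (u (m\<^sup>- \<star> k))"
  have f: "s g \<cdot> translate g (t (g\<^sup>- \<star> m)) \<in> carrier A" "translate m (u (m\<^sup>- \<star> k)) \<in> carrier A"
    if "g \<in> ?C" "m \<in> ?C" for g m
    using costarD[OF that(1)] costarD[OF that(2)] k S_apply stu by auto
  have "(s \<otimes>\<^bsub>S\<^esub> t \<otimes>\<^bsub>S\<^esub> u) k = finsum A (\<lambda>m. finsum A (\<lambda>g. ?f g m) ?C) ?C"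
    unfolding mult_apply[OF mult_S_closed[OF stu(1,2)] stu(3) k]
  proof (rule finsum_cong'[OF refl])
    fix m assume m: "m \<in> ?C"
    then have m': "m \<in> carrier G" "tgt G m = tgt G k" by (auto simp: costar_def)
    show "(s \<otimes>\<^bsub>S\<^esub> t) m \<cdot> translate m (u (m\<^sup>- \<star> k)) = finsum A (\<lambda>g. ?f g m) ?C"
      unfolding mult_apply[OF stu(1,2) m'(1)] m'(2) using f m
      by (intro rng_finsum_ldistr) auto
  qed (use f in \<open>auto intro!: finsum_closed\<close>)
  also have "\<dots> = finsum A (\<lambda>g. finsum A (?f g) ?C) ?C"
    using f by (intro finsum_swap) auto
  also have "\<dots> = (s \<otimes>\<^bsub>S\<^esub> (t \<otimes>\<^bsub>S\<^esub> u)) k"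
    unfolding mult_apply[OF stu(1) mult_S_closed[OF stu(2,3)] k]
  proof (rule sym, rule finsum_cong'[OF refl])
    fix g assume g: "g \<in> ?C"
    note g' = costarD[OF g]
    let ?h = "\<lambda>h. t h \<cdot> translate h (u (h\<^sup>- \<star> (g\<^sup>- \<star> k)))"
    have h: "?h h \<in> carrier A" if "h \<in> costar (src G g)" for h
      using costarD[OF that] g' k S_apply stu by auto
    have gi: "g\<^sup>- \<in> carrier G" "src G (g\<^sup>-) = tgt G k" "tgt G (g\<^sup>-) = src G g"
      using g' by auto
    have "s g \<cdot> translate g ((t \<otimes>\<^bsub>S\<^esub> u) (g\<^sup>- \<star> k))
        = s g \<cdot> translate g (finsum A ?h (costar (src G g)))"
      using mult_apply[OF stu(2,3), of "g\<^sup>- \<star> k"] g' k by simp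
    also have "\<dots> = finsum A (\<lambda>h. s g \<cdot> translate g (?h h)) (costar (src G g))"
      using h g' S_apply[OF stu(1) g'(1)]
      by (simp add: translate_finsum rng_finsum_rdistr Pi_iff)
    \<comment> \<open>Substitution of \<open>g\<^sup>- \<star> m\<close> for the middle factor
      \<open>h\<close>.\<close>
    also have "\<dots> = finsum A (\<lambda>m. s g \<cdot> translate g (?h (g\<^sup>- \<star> m))) ?C"
      using h g' S_apply[OF stu(1) g'(1)] costar_shift[OF gi(1)] unfolding gi
      by (simp add: finsum_reindex Pi_iff)
    also have "\<dots> = finsum A (?f g) ?C"
      using S_assoc_term[OF stu k g] f[OF g] by (intro finsum_cong') auto
    finally show "s g \<cdot> translate g ((t \<otimes>\<^bsub>S\<^esub> u) (g\<^sup>- \<star> k)) = finsum A (?f g) ?C" .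
  qed (use f in \<open>auto intro!: finsum_closed\<close>)
  finally show "(s \<otimes>\<^bsub>S\<^esub> t \<otimes>\<^bsub>S\<^esub> u) k = (s \<otimes>\<^bsub>S\<^esub> (t \<otimes>\<^bsub>S\<^esub> u)) k" .
qed (intro mult_S_closed stu)+

section \<open>The copy of \<open>A\<close> in the skew ring\<close>

lemma embedding_apply:
  "g \<in> carrier G \<Longrightarrow> skew_embedding G A B r g = (if g \<in> objects G then r \<cdot> idem g else \<zero>\<^bsub>A\<^esub>)"
  by (simp add: skew_embedding_def)

lemma embedding_closed: "r \<in> carrier A \<Longrightarrow> skew_embedding G A B r \<in> carrier S"
  by (auto simp: carrier_S skew_embedding_def)

text \<open>The only object with the target of \<open>k\<close> is \<open>tgt G k\<close> itself,
  and its idempotent acts trivially on \<open>B k\<close>.\<close>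

lemma embedding_times:
  assumes r: "r \<in> carrier A" and s: "s \<in> carrier S" and k: "k \<in> carrier G"
  shows "(skew_embedding G A B r \<otimes>\<^bsub>S\<^esub> s) k = r \<cdot> s k"
proof -
  have sk: "s k \<in> B k" "s k \<in> carrier A" using S_apply[OF s k] by auto
  have "(skew_embedding G A B r \<otimes>\<^bsub>S\<^esub> s) k
      = skew_embedding G A B r (tgt G k) \<cdot> translate (tgt G k) (s ((tgt G k)\<^sup>- \<star> k))"
  proof (rule mult_apply_single[OF embedding_closed[OF r] s k])
    fix g assume "g \<in> carrier G" "tgt G g = tgt G k" "g \<noteq> tgt G k"
    then show "skew_embedding G A B r g = \<zero>\<^bsub>A\<^esub> \<or> s (g\<^sup>- \<star> k) = \<zero>\<^bsub>A\<^esub>"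
      using tgt_object[of g] by (auto simp: embedding_apply)
  qed (use k in auto)
  also have "\<dots> = (r \<cdot> idem (tgt G k)) \<cdot> (s k \<cdot> idem (tgt G k))"
    using k sk by (simp add: embedding_apply translate_object)
  also have "\<dots> = r \<cdot> (idem (tgt G k) \<cdot> s k)"
    using r k sk idem_commute[of "tgt G k" "s k"]
    by (metis idem_B idem_carrier idem_times object_carrier rng_assoc rng_closed tgt_in_objects)
  also have "idem (tgt G k) \<cdot> s k = s k"
    using rng_assoc[of "idem (tgt G k)" "idem k" "s k"] k sk by (simp add: idem_tgt)
  finally show ?thesis .
qed

text \<open>On the right, elements of \<open>A\<close> act twisted by \<open>translate k\<close>.
  This is the rule by which coefficients are later moved past a monomial and across the tensor
  sign.\<close>

lemma times_embedding:
  assumes r: "r \<in> carrier A" and s: "s \<in> carrier S" and k: "k \<in> carrier G"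
  shows "(s \<otimes>\<^bsub>S\<^esub> skew_embedding G A B r) k = s k \<cdot> translate k r"
proof -
  have sk: "s k \<in> B k" "s k \<in> carrier A" using S_apply[OF s k] by auto
  have "(s \<otimes>\<^bsub>S\<^esub> skew_embedding G A B r) k
      = s k \<cdot> translate k (skew_embedding G A B r (k\<^sup>- \<star> k))"
  proof (rule mult_apply_single[OF s embedding_closed[OF r] k k refl])
    fix g assume g: "g \<in> carrier G" "tgt G g = tgt G k" "g \<noteq> k"
    have "g\<^sup>- \<star> k \<notin> objects G"
    proof
      assume o: "g\<^sup>- \<star> k \<in> objects G"
      then have "g\<^sup>- \<star> k = src G g"
        using tgt_object[OF o, symmetric] g k by (simp only: tgt_cmp src_ginv tgt_ginv ginv_closed)
      then have "g \<star> (g\<^sup>- \<star> k) = g" using g k by simp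
      then show False using g k by simp
    qed
    then show "s g = \<zero>\<^bsub>A\<^esub> \<or> skew_embedding G A B r (g\<^sup>- \<star> k) = \<zero>\<^bsub>A\<^esub>"
      using g k by (simp add: embedding_apply)
  qed
  also have "\<dots> = s k \<cdot> (translate k r \<cdot> (idem k \<cdot> idem k))"
    using k r by (simp add: embedding_apply translate_times translate_idem)
  also have "\<dots> = s k \<cdot> translate k r"
    using k r by simp
  finally show ?thesis .
qed

lemma embedding_identity: "skew_embedding G A B unity = \<one>\<^bsub>S\<^esub>"
  by (auto simp: skew_embedding_def one_S unity_times intro!: restrict_ext)

lemma ring_S: "ring S"
proof (rule ringI)
  show "abelian_group S" by (rule abelian_group_S)
  show "monoid S"
  proof (rule monoidI)
    fix s assume s: "s \<in> carrier S"
    show "\<one>\<^bsub>S\<^esub> \<otimes>\<^bsub>S\<^esub> s = s"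
      unfolding embedding_identity[symmetric] using s
      by (intro S_eqI mult_S_closed embedding_closed) (auto simp: embedding_times unity_times S_apply)
    show "s \<otimes>\<^bsub>S\<^esub> \<one>\<^bsub>S\<^esub> = s"
      unfolding embedding_identity[symmetric]
    proof (rule S_eqI)
      fix k assume k: "k \<in> carrier G"
      \<comment> \<open>\<open>translate k\<close> sees only the part cut out by 1_(k^-1), where
        \<open>unity\<close> is an identity. Its value is therefore 1_k 1_(tgt k), which is
        1_k.\<close>
      have "translate k unity = translate k (unity \<cdot> idem (k\<^sup>-))"
        using k by (simp add: translate_def rng_assoc)
      also have "\<dots> = idem k"
        using k translate_idem[of k "k\<^sup>-"] idem_tgt[of k] idem_commute[of k "idem (tgt G k)"]
        by (simp add: unity_times)
      finally show "(s \<otimes>\<^bsub>S\<^esub> skew_embedding G A B unity) k = s k"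
        using s k S_apply[OF s k] by (simp add: times_embedding)
    qed (intro mult_S_closed embedding_closed unity_closed s)+
  qed (simp_all add: mult_S_closed one_S_closed S_assoc)
qed (simp_all add: S_l_distr S_r_distr)

lemma carrier_with_one: "carrier (with_one A) = carrier A"
  by (simp add: with_one_def)

lemma embedding_ring_hom: "skew_embedding G A B \<in> ring_hom (with_one A) S"
proof (rule ring_hom_memI)
  fix a b assume ab: "a \<in> carrier (with_one A)" "b \<in> carrier (with_one A)"
  then have ab': "a \<in> carrier A" "b \<in> carrier A" by (simp_all add: with_one_def)
  have "skew_embedding G A B (a \<cdot> b) = skew_embedding G A B a \<otimes>\<^bsub>S\<^esub> skew_embedding G A B b"
    using ab' by (intro S_eqI embedding_closed mult_S_closed rng_closed)
      (auto simp: embedding_times embedding_closed embedding_apply rng_assoc)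
  then show "skew_embedding G A B (a \<otimes>\<^bsub>with_one A\<^esub> b)
      = skew_embedding G A B a \<otimes>\<^bsub>S\<^esub> skew_embedding G A B b"
    by (simp add: with_one_def)
  have "skew_embedding G A B (a \<^bold>+ b) = skew_embedding G A B a \<oplus>\<^bsub>S\<^esub> skew_embedding G A B b"
    using ab' by (intro S_eqI embedding_closed plus_S_closed a_closed)
      (auto simp: plus_S embedding_apply rng_l_distr)
  then show "skew_embedding G A B (a \<oplus>\<^bsub>with_one A\<^esub> b)
      = skew_embedding G A B a \<oplus>\<^bsub>S\<^esub> skew_embedding G A B b"
    by (simp add: with_one_def)
qed (simp_all add: with_one_def identity_of_unity embedding_identity embedding_closed)

section \<open>The bimodule map\<close>

definition object_sum :: "('g \<Rightarrow> 'a) \<Rightarrow> 'a" where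
  "object_sum s = finsum A s (objects G)"

text \<open>Yields the injectivity of the embedding.\<close>

lemma object_sum_embedding:
  assumes "r \<in> carrier A" shows "object_sum (skew_embedding G A B r) = r"
proof -
  have "object_sum (skew_embedding G A B r) = finsum A (\<lambda>y. r \<cdot> idem y) (objects G)"
    unfolding object_sum_def using assms by (intro finsum_cong') (auto simp: embedding_apply)
  also have "\<dots> = r \<cdot> unity"
    unfolding unity_def using assms by (intro rng_finsum_rdistr[symmetric] finite_objects) auto
  finally show ?thesis using assms by (simp add: times_unity)
qed

lemma ring_extension_S: "ring_extension (with_one A) S (skew_embedding G A B)"
  unfolding ring_extension_def
proof (intro conjI ring_with_one ring_S embedding_ring_hom)
  show "inj_on (skew_embedding G A B) (carrier (with_one A))"
    by (rule inj_on_inverseI[of _ object_sum]) (simp add: with_one_def object_sum_embedding)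
qed

lemma object_sum_closed: "s \<in> carrier S \<Longrightarrow> object_sum s \<in> carrier A"
  unfolding object_sum_def by (intro finsum_closed) (auto simp: S_apply)

lemma bimodule_map_object_sum: "bimodule_map (with_one A) S (skew_embedding G A B) object_sum"
  unfolding bimodule_map_def
proof (intro conjI ballI)
  show "object_sum \<in> carrier S \<rightarrow> carrier (with_one A)"
    by (simp add: with_one_def object_sum_closed)
next
  fix s t assume st: "s \<in> carrier S" "t \<in> carrier S"
  have "object_sum (s \<oplus>\<^bsub>S\<^esub> t) = finsum A (\<lambda>y. s y \<^bold>+ t y) (objects G)"
    unfolding object_sum_def using st by (intro finsum_cong') (auto simp: plus_S S_apply)
  also have "\<dots> = object_sum s \<^bold>+ object_sum t"
    unfolding object_sum_def using st by (intro finsum_addf) (auto simp: S_apply)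
  finally show "object_sum (s \<oplus>\<^bsub>S\<^esub> t) = object_sum s \<oplus>\<^bsub>with_one A\<^esub> object_sum t"
    by (simp add: with_one_def)
next
  fix r s assume "r \<in> carrier (with_one A)" and s: "s \<in> carrier S"
  then have r: "r \<in> carrier A" by (simp add: with_one_def)
  have "object_sum (skew_embedding G A B r \<otimes>\<^bsub>S\<^esub> s) = finsum A (\<lambda>y. r \<cdot> s y) (objects G)"
    unfolding object_sum_def using r s by (intro finsum_cong') (auto simp: embedding_times S_apply)
  also have "\<dots> = r \<cdot> object_sum s"
    unfolding object_sum_def using r s
    by (intro rng_finsum_rdistr[symmetric] finite_objects) (auto simp: S_apply)
  finally show "object_sum (skew_embedding G A B r \<otimes>\<^bsub>S\<^esub> s) = r \<otimes>\<^bsub>with_one A\<^esub> object_sum s"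
    by (simp add: with_one_def)
  \<comment> \<open>At an object the twist degenerates to multiplication by \<open>idem y\<close>,
    absorbed by \<open>s y\<close>. This is why restricting to object coefficients is linear on the
    right as well.\<close>
  have s_r: "(s \<otimes>\<^bsub>S\<^esub> skew_embedding G A B r) y = s y \<cdot> r" if y: "y \<in> objects G" for y
  proof -
    have "(s \<otimes>\<^bsub>S\<^esub> skew_embedding G A B r) y = s y \<cdot> (idem y \<cdot> r)"
      using y r s by (simp add: times_embedding translate_object idem_commute)
    also have "\<dots> = s y \<cdot> r"
      using y r S_apply[OF s, of y] by (simp flip: rng_assoc)
    finally show ?thesis .
  qed
  have "object_sum (s \<otimes>\<^bsub>S\<^esub> skew_embedding G A B r) = finsum A (\<lambda>y. s y \<cdot> r) (objects G)"
    unfolding object_sum_def using r s by (intro finsum_cong') (auto simp: s_r S_apply)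
  also have "\<dots> = object_sum s \<cdot> r"
    unfolding object_sum_def using r s
    by (intro rng_finsum_ldistr[symmetric] finite_objects) (auto simp: S_apply)
  finally show "object_sum (s \<otimes>\<^bsub>S\<^esub> skew_embedding G A B r) = object_sum s \<otimes>\<^bsub>with_one A\<^esub> r"
    by (simp add: with_one_def)
qed

section \<open>Monomials\<close>

abbreviation \<delta> where "\<delta> g a \<equiv> delta G A g a"

lemma delta_apply: "k \<in> carrier G \<Longrightarrow> \<delta> g a k = (if k = g then a else \<zero>\<^bsub>A\<^esub>)"
  by (simp add: delta_def)

lemma delta_closed [simp]: "g \<in> carrier G \<Longrightarrow> a \<in> B g \<Longrightarrow> \<delta> g a \<in> carrier S"
  by (auto simp: carrier_S delta_def)

lemma delta_times_delta:
  assumes h: "h \<in> carrier G" "a \<in> B h" and g: "g \<in> carrier G" "b \<in> B g"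
  shows "\<delta> h a \<otimes>\<^bsub>S\<^esub> \<delta> g b =
    (if src G h = tgt G g then \<delta> (h \<star> g) (a \<cdot> translate h b) else \<zero>\<^bsub>S\<^esub>)"
proof -
  have d: "\<delta> h a \<in> carrier S" "\<delta> g b \<in> carrier S" using assms by auto
  have a: "a \<in> carrier A" and b: "b \<in> carrier A" using assms B_carrier by auto
  have val: "(\<delta> h a \<otimes>\<^bsub>S\<^esub> \<delta> g b) k =
      (if src G h = tgt G g \<and> k = h \<star> g then a \<cdot> translate h b else \<zero>\<^bsub>A\<^esub>)" if k: "k \<in> carrier G" for k
  proof (cases "tgt G h = tgt G k")
    case True
    have "(\<delta> h a \<otimes>\<^bsub>S\<^esub> \<delta> g b) k = \<delta> h a h \<cdot> translate h (\<delta> g b (h\<^sup>- \<star> k))"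
      by (rule mult_apply_single[OF d k h(1) True]) (simp add: delta_apply)
    moreover have "h\<^sup>- \<star> k = g \<longleftrightarrow> src G h = tgt G g \<and> k = h \<star> g"
      using True h g k by auto
    ultimately show ?thesis
      using True h g k a b by (simp add: delta_apply)
  next
    case False
    \<comment> \<open>No factorization of \<open>k\<close> begins with \<open>h\<close>, so every
      term is zero; \<open>k\<close> is an arbitrary choice of the term to single out.\<close>
    have "(\<delta> h a \<otimes>\<^bsub>S\<^esub> \<delta> g b) k = \<delta> h a k \<cdot> translate k (\<delta> g b (k\<^sup>- \<star> k))"
      using False by (intro mult_apply_single[OF d k k refl]) (auto simp: delta_apply)
    moreover have "\<not> (src G h = tgt G g \<and> k = h \<star> g)"
      using False h g by auto
    ultimately show ?thesis
      using False h g k b by (auto simp: delta_apply)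
  qed
  show ?thesis
  proof (cases "src G h = tgt G g")
    case True
    have "a \<cdot> translate h b \<in> B (h \<star> g)"
      using mult_term_B[OF d, of "h \<star> g" h] True h g by (simp add: costar_def delta_apply)
    then show ?thesis
      using True h g d by (intro S_eqI mult_S_closed) (auto simp: val delta_apply)
  next
    case False
    then show ?thesis
      using d zero_S_closed by (intro S_eqI mult_S_closed) (auto simp: val zero_S)
  qed
qed

lemma embedding_times_delta:
  assumes "r \<in> carrier A" "g \<in> carrier G" "a \<in> B g"
  shows "skew_embedding G A B r \<otimes>\<^bsub>S\<^esub> \<delta> g a = \<delta> g (r \<cdot> a)"
  using assms by (intro S_eqI mult_S_closed) (auto simp: embedding_times embedding_closed delta_apply)

lemma delta_times_embedding:
  assumes "r \<in> carrier A" "g \<in> carrier G" "a \<in> B g"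
  shows "\<delta> g a \<otimes>\<^bsub>S\<^esub> skew_embedding G A B r = \<delta> g (a \<cdot> translate g r)"
  using assms by (intro S_eqI mult_S_closed) (auto simp: times_embedding embedding_closed delta_apply)

lemma finsum_S_apply:
  assumes "finite X" "f \<in> X \<rightarrow> carrier S" "k \<in> carrier G"
  shows "finsum S f X k = finsum A (\<lambda>i. f i k) X"
proof -
  interpret S: ring S by (rule ring_S)
  show ?thesis
    using assms(1,2)
  proof (induction X)
    case empty
    then show ?case using assms(3) by (simp add: zero_S)
  next
    case (insert i X)
    then have "f i \<in> carrier S" "f \<in> X \<rightarrow> carrier S" by auto
    moreover have "f i k \<in> carrier A" "(\<lambda>i. f i k) \<in> X \<rightarrow> carrier A"
      using insert assms(3) by (auto simp: S_apply Pi_iff)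
    ultimately show ?case
      using insert assms(3) by (simp add: plus_S)
  qed
qed

text \<open>Reduces additive statements about the skew ring to monomials.\<close>

lemma delta_expansion:
  assumes s: "s \<in> carrier S"
  shows "s = finsum S (\<lambda>h. \<delta> h (s h)) (carrier G)"
proof -
  interpret S: ring S by (rule ring_S)
  have d: "(\<lambda>h. \<delta> h (s h)) \<in> carrier G \<rightarrow> carrier S"
    using S_apply[OF s] by auto
  show ?thesis
  proof (rule S_eqI[OF s S.finsum_closed[OF d]])
    fix k assume k: "k \<in> carrier G"
    have "finsum A (\<lambda>h. \<delta> h (s h) k) (carrier G) = \<delta> k (s k) k"
      using k S_apply[OF s] by (intro finsum_single finite_arrows) (auto simp: delta_apply)
    then show "s k = finsum S (\<lambda>h. \<delta> h (s h)) (carrier G) k"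
      using k finsum_S_apply[OF finite_arrows d k] by (simp add: delta_apply)
  qed
qed

section \<open>The Frobenius tensor\<close>

abbreviation unit_delta where "unit_delta g \<equiv> \<delta> g (idem g)"

lemma object_sum_unit_delta:
  assumes "g \<in> carrier G"
  shows "object_sum (unit_delta g) = (if g \<in> objects G then idem g else \<zero>\<^bsub>A\<^esub>)"
proof (cases "g \<in> objects G")
  case True
  have "object_sum (unit_delta g) = unit_delta g g"
    unfolding object_sum_def using True assms
    by (intro finsum_single finite_objects) (auto simp: delta_apply)
  then show ?thesis using True by (simp add: delta_apply)
next
  case False
  have "object_sum (unit_delta g) = finsum A (\<lambda>y. \<zero>\<^bsub>A\<^esub>) (objects G)"
    unfolding object_sum_def using False by (intro finsum_cong') (auto simp: delta_apply)
  then show ?thesis using False by simp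
qed

lemma ginv_in_objects_iff: "g \<in> carrier G \<Longrightarrow> ginv G g \<in> objects G \<longleftrightarrow> g \<in> objects G"
  by (metis ginv_ginv ginv_object)

text \<open>The map \<open>object_sum\<close> kills \<open>unit_delta g\<close> unless
  \<open>g\<close> is an object, and an object is its own inverse; the surviving terms are exactly
  the summands of the identity.\<close>

lemma frobenius_left:
  "finsum S (\<lambda>g. skew_embedding G A B (object_sum (unit_delta g)) \<otimes>\<^bsub>S\<^esub> unit_delta (g\<^sup>-)) (carrier G)
    = \<one>\<^bsub>S\<^esub>" (is "finsum S ?f _ = _")
proof -
  interpret S: ring S by (rule ring_S)
  have f: "?f \<in> carrier G \<rightarrow> carrier S"
    by (auto intro!: mult_S_closed embedding_closed object_sum_closed)
  show ?thesis
  proof (rule S_eqI[OF S.finsum_closed[OF f] one_S_closed])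
    fix k assume k: "k \<in> carrier G"
    have val: "?f g k = (if g \<in> objects G \<and> g = k then idem k else \<zero>\<^bsub>A\<^esub>)" if "g \<in> carrier G" for g
      using that k by (auto simp: embedding_times object_sum_unit_delta delta_apply)
    have "finsum S ?f (carrier G) k = finsum A (\<lambda>g. ?f g k) (carrier G)"
      by (rule finsum_S_apply[OF finite_arrows f k])
    also have "\<dots> = ?f k k"
      using k by (intro finsum_single finite_arrows) (auto simp: val)
    finally show "finsum S ?f (carrier G) k = \<one>\<^bsub>S\<^esub> k"
      using k by (simp add: val one_S)
  qed
qed

lemma frobenius_right:
  "finsum S (\<lambda>g. unit_delta g \<otimes>\<^bsub>S\<^esub> skew_embedding G A B (object_sum (unit_delta (g\<^sup>-)))) (carrier G)
    = \<one>\<^bsub>S\<^esub>" (is "finsum S ?f _ = _")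
proof -
  interpret S: ring S by (rule ring_S)
  have f: "?f \<in> carrier G \<rightarrow> carrier S"
    by (auto intro!: mult_S_closed embedding_closed object_sum_closed)
  show ?thesis
  proof (rule S_eqI[OF S.finsum_closed[OF f] one_S_closed])
    fix k assume k: "k \<in> carrier G"
    have val: "?f g k = (if g \<in> objects G \<and> g = k then idem k else \<zero>\<^bsub>A\<^esub>)" if "g \<in> carrier G" for g
      using that k ginv_in_objects_iff[OF that]
      by (auto simp: times_embedding object_sum_unit_delta delta_apply translate_object)
    have "finsum S ?f (carrier G) k = finsum A (\<lambda>g. ?f g k) (carrier G)"
      by (rule finsum_S_apply[OF finite_arrows f k])
    also have "\<dots> = ?f k k"
      using k by (intro finsum_single finite_arrows) (auto simp: val)
    finally show "finsum S ?f (carrier G) k = \<one>\<^bsub>S\<^esub> k"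
      using k by (simp add: val one_S)
  qed
qed

abbreviation "SS \<equiv> tensor_square (with_one A) S (skew_embedding G A B)"
abbreviation "pten \<equiv> pure_tensor (with_one A) S (skew_embedding G A B)"

lemma casimir_delta:
  assumes h: "h \<in> carrier G" and a: "a \<in> B h"
  shows "finprod SS (\<lambda>g. pten (\<delta> h a \<otimes>\<^bsub>S\<^esub> unit_delta g) (unit_delta (g\<^sup>-))) (carrier G) =
    finprod SS (\<lambda>g. pten (unit_delta g) (unit_delta (g\<^sup>-) \<otimes>\<^bsub>S\<^esub> \<delta> h a)) (carrier G)"
    (is "finprod SS ?l _ = finprod SS ?r _")
proof -
  interpret S: ring S by (rule ring_S)
  interpret TS: balanced_tensors S "with_one A" "skew_embedding G A B"
    by (rule balanced_tensors_ring_extension[OF ring_extension_S])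
  have ac: "a \<in> carrier A" using h a B_carrier by auto
  have d: "\<delta> h a \<in> carrier S" using h a by simp
  have l: "?l g \<in> carrier SS" and r: "?r g \<in> carrier SS" if "g \<in> carrier G" for g
    using that d by (auto intro!: TS.pt_closed mult_S_closed)
  \<comment> \<open>Arrows that do not compose with \<open>h\<close> give the zero product, hence
    the neutral element of the multiplicatively written tensor square. The two products may thus be
    cut down to sets that left multiplication by \<open>h\<close> matches.\<close>
  have l0: "?l g = \<one>\<^bsub>SS\<^esub>" if "g \<in> carrier G" "g \<notin> costar (src G h)" for g
    using that h a by (auto simp: delta_times_delta costar_def)
  have r0: "?r g = \<one>\<^bsub>SS\<^esub>" if "g \<in> carrier G" "g \<notin> costar (tgt G h)" for g
    using that h a by (auto simp: delta_times_delta costar_def)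
  have shift: "?l g = ?r (h \<star> g)" if "g \<in> costar (src G h)" for g
  proof -
    define k where "k = h \<star> g"
    \<comment> \<open>Chosen so that \<open>translate k b\<close> recovers \<open>a\<close> up to
      the factor \<open>idem k\<close>, which makes \<open>b\<close> the coefficient that can leave
      the first tensor factor on its right.\<close>
    define b where "b = translate (k\<^sup>-) a"
    have g: "g \<in> carrier G" "tgt G g = src G h" using that by (auto simp: costar_def)
    have k: "k \<in> carrier G" "tgt G k = tgt G h" "src G k = src G g" using g h by (auto simp: k_def)
    have kh: "k\<^sup>- \<star> h = g\<^sup>-"
      using g h cmp_src[of "g\<^sup>-"] by (simp add: k_def ginv_cmp_distrib cmp_assoc)
    have b: "b \<in> B (k\<^sup>-)" "b \<in> carrier A"
      using k ac by (auto simp: b_def)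
    have b_g: "b \<cdot> idem (g\<^sup>-) = b"
    \<comment> \<open>Since \<open>a\<close> is a multiple of \<open>idem h\<close>, its translate
      is a multiple of \<open>translate (k\<^sup>-) (idem h)\<close>, that is, of 1_(k^-1) 1_(g^-1),
      because k^-1 h = g^-1.\<close>
    proof -
      have "b = translate (k\<^sup>-) (a \<cdot> idem h)" using a h by (simp add: b_def)
      also have "\<dots> = b \<cdot> (idem (k\<^sup>-) \<cdot> idem (g\<^sup>-))"
        using ac h k kh by (simp add: translate_times translate_idem b_def)
      also have "\<dots> = b \<cdot> idem (g\<^sup>-)"
        using b g k by (simp flip: rng_assoc)
      finally show ?thesis by simp
    qed
    have "\<delta> h a \<otimes>\<^bsub>S\<^esub> unit_delta g = \<delta> k (a \<cdot> translate h (idem g))"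
      using g h a by (simp add: delta_times_delta k_def)
    also have "a \<cdot> translate h (idem g) = a \<cdot> idem k"
      using g h a ac by (simp add: translate_idem k_def flip: rng_assoc)
    also have "\<dots> = idem k \<cdot> translate k b"
    proof -
      \<comment> \<open>Translating by k^-1 and then by k gives 1_k times the translate by the
        object \<open>tgt G k\<close>. The idempotent of that object is also that of
        \<open>tgt G h\<close>, so it fixes \<open>a\<close>.\<close>
      have "translate k b = idem k \<cdot> (a \<cdot> idem (tgt G k))"
        using k ac translate_object[OF tgt_in_objects[OF h] ac]
        by (simp add: b_def translate_translate)
      also have "a \<cdot> idem (tgt G k) = a"
        using h a ac k idem_tgt[of h] idem_commute[of "tgt G h" a] rng_assoc[of "idem (tgt G h)" "idem h" a]
        by simp
      finally show ?thesis
        using k ac by (simp add: idem_commute flip: rng_assoc)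
    qed
    finally have "\<delta> h a \<otimes>\<^bsub>S\<^esub> unit_delta g = unit_delta k \<otimes>\<^bsub>S\<^esub> skew_embedding G A B b"
      using k b by (simp add: delta_times_embedding)
    then have "?l g = pten (unit_delta k) (skew_embedding G A B b \<otimes>\<^bsub>S\<^esub> unit_delta (g\<^sup>-))"
      using k g TS.pt_balanced[of "unit_delta k" "unit_delta (g\<^sup>-)" b] b(2)[folded carrier_with_one]
      by simp
    \<comment> \<open>Both sides are monomials at \<open>g\<^sup>-\<close>: the left has coefficient
      \<open>b \<cdot> idem (g\<^sup>-)\<close>, the right
      \<open>idem (k\<^sup>-) \<cdot> b\<close>, and both equal \<open>b\<close>.\<close>
    also have "skew_embedding G A B b \<otimes>\<^bsub>S\<^esub> unit_delta (g\<^sup>-) = unit_delta (k\<^sup>-) \<otimes>\<^bsub>S\<^esub> \<delta> h a"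
      using k g b h a b_g kh by (simp add: embedding_times_delta delta_times_delta b_def[symmetric])
    finally show ?thesis by (simp add: k_def)
  qed
  have "finprod SS ?l (carrier G) = finprod SS ?l (costar (src G h))"
    using l l0 by (intro TS.T.finprod_mono_neutral_cong_right finite_arrows) (auto simp: costar_def)
  also have "\<dots> = finprod SS (\<lambda>g. ?r (h \<star> g)) (costar (src G h))"
    using shift r h by (intro TS.T.finprod_cong') (auto simp: costar_def)
  also have "\<dots> = finprod SS ?r (costar (tgt G h))"
  proof -
    have "?r \<in> (\<lambda>g. h \<star> g) ` costar (src G h) \<rightarrow> carrier SS"
      unfolding costar_shift(1)[OF h, symmetric] using r costarD(1) by blast
    from TS.T.finprod_reindex[OF this costar_shift(2)[OF h]] show ?thesis
      unfolding costar_shift(1)[OF h, symmetric] by (rule sym)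
  qed
  also have "\<dots> = finprod SS ?r (carrier G)"
    using r r0 by (intro TS.T.finprod_mono_neutral_cong_left finite_arrows) (auto simp: costar_def)
  finally show ?thesis .
qed

lemma casimir:
  assumes "s \<in> carrier S"
  shows "finprod SS (\<lambda>g. pten (s \<otimes>\<^bsub>S\<^esub> unit_delta g) (unit_delta (g\<^sup>-))) (carrier G) =
    finprod SS (\<lambda>g. pten (unit_delta g) (unit_delta (g\<^sup>-) \<otimes>\<^bsub>S\<^esub> s)) (carrier G)"
proof -
  interpret S: ring S by (rule ring_S)
  interpret TS: balanced_tensors S "with_one A" "skew_embedding G A B"
    by (rule balanced_tensors_ring_extension[OF ring_extension_S])
  let ?l = "\<lambda>s g. pten (s \<otimes>\<^bsub>S\<^esub> unit_delta g) (unit_delta (g\<^sup>-))"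
  let ?r = "\<lambda>s g. pten (unit_delta g) (unit_delta (g\<^sup>-) \<otimes>\<^bsub>S\<^esub> s)"
  let ?C = "{s \<in> carrier S. finprod SS (?l s) (carrier G) = finprod SS (?r s) (carrier G)}"
  have lr: "?l s \<in> carrier G \<rightarrow> carrier SS" "?r s \<in> carrier G \<rightarrow> carrier SS" if "s \<in> carrier S" for s
    using that by (auto intro!: TS.pt_closed mult_S_closed)
  \<comment> \<open>The elements satisfying the identity contain zero and are closed under addition,
    by biadditivity of the tensor, so the case of monomials suffices.\<close>
  have "finsum S (\<lambda>h. \<delta> h (s h)) (carrier G) \<in> ?C"
  proof (rule S.finsum_mem[OF finite_arrows])
    have "finprod SS (?l \<zero>\<^bsub>S\<^esub>) (carrier G) = \<one>\<^bsub>SS\<^esub>" "finprod SS (?r \<zero>\<^bsub>S\<^esub>) (carrier G) = \<one>\<^bsub>SS\<^esub>"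
      by (auto intro!: TS.T.finprod_one_eqI)
    then show "\<zero>\<^bsub>S\<^esub> \<in> ?C" by simp
    fix s t assume "s \<in> ?C" "t \<in> ?C"
    then have st: "s \<in> carrier S" "t \<in> carrier S"
      and eq: "finprod SS (?l s) (carrier G) = finprod SS (?r s) (carrier G)"
        "finprod SS (?l t) (carrier G) = finprod SS (?r t) (carrier G)" by auto
    have "finprod SS (?l (s \<oplus>\<^bsub>S\<^esub> t)) (carrier G) = finprod SS (\<lambda>g. ?l s g \<otimes>\<^bsub>SS\<^esub> ?l t g) (carrier G)"
      using st lr by (intro TS.T.finprod_cong') (auto simp: S.l_distr TS.pt_plus_left Pi_iff)
    also have "\<dots> = finprod SS (\<lambda>g. ?r s g \<otimes>\<^bsub>SS\<^esub> ?r t g) (carrier G)"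
      using st lr eq by (simp add: TS.T.finprod_multf)
    also have "\<dots> = finprod SS (?r (s \<oplus>\<^bsub>S\<^esub> t)) (carrier G)"
      using st lr by (intro TS.T.finprod_cong') (auto simp: S.r_distr TS.pt_plus_right Pi_iff)
    finally show "s \<oplus>\<^bsub>S\<^esub> t \<in> ?C" using st by simp
  next
    fix h assume h: "h \<in> carrier G"
    then show "\<delta> h (s h) \<in> ?C"
      using casimir_delta[OF h] S_apply[OF assms h] by simp
  qed simp
  then show ?thesis
    using delta_expansion[OF assms] by simp
qed

theorem frobenius_skew_ring: "frobenius_extension (with_one A) S (skew_embedding G A B)"
  by (rule frobenius_extensionI[OF ring_extension_S finite_arrows _ _ bimodule_map_object_sum
        casimir frobenius_left frobenius_right]) auto

end


section \<open>Restriction to an isotropy group\<close>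

lemma (in rng) rng_ideal_self:
  assumes "rng_ideal J R" shows "rng_ideal J (R\<lparr>carrier := J\<rparr>)"
proof -
  interpret J: rng "R\<lparr>carrier := J\<rparr>" by (rule rng_rng_ideal[OF assms])
  show ?thesis
    using J.add.subgroup_self J.rng_closed by (auto simp: rng_ideal_def additive_subgroup_def)
qed

lemma rng_iso_carrier_update [simp]: "rng_iso (R\<lparr>carrier := J\<rparr>) P Q u \<longleftrightarrow> rng_iso R P Q u"
  by (simp add: rng_iso_iff)

text \<open>The isotropy group has the single object \<open>x\<close>, so the required direct sum
  decomposition is that of \<open>B x\<close> into itself; the other conditions are inherited from
  \<open>G\<close>.\<close>

lemma (in unital_partial_action) restriction:
  assumes x: "x \<in> objects G"
  shows "unital_partial_action (A\<lparr>carrier := B x\<rparr>) (isotropy G x) B \<beta>"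
proof -
  have J: "rng_ideal (B x) A" by (rule B_ideal) (use x in simp)
  interpret J: rng "A\<lparr>carrier := B x\<rparr>" by (rule rng_rng_ideal[OF J])
  interpret X: groupoid "isotropy G x" by (rule groupoid_isotropy)
  note self = rng_ideal_self[OF J]
  show ?thesis
  proof
    show "finite (carrier (isotropy G x))"
      using finite_arrows by (simp add: arrows_def)
    show "partial_action (isotropy G x) (A\<lparr>carrier := B x\<rparr>) B \<beta>"
      using partial_action x self unfolding partial_action_def by (auto simp: arrows_def)
    show "unital_rng (A\<lparr>carrier := B x, carrier := B g\<rparr>)" if "g \<in> carrier (isotropy G x)" for g
      using that unital by (simp add: arrows_def)
    have "\<exists>!c. c \<in> PiE {x} B \<and> a = finsum (A\<lparr>carrier := B x\<rparr>) c {x}" if a: "a \<in> B x" for a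
    proof (rule ex1I[of _ "\<lambda>y\<in>{x}. a"])
      show "(\<lambda>y\<in>{x}. a) \<in> PiE {x} B \<and> a = finsum (A\<lparr>carrier := B x\<rparr>) (\<lambda>y\<in>{x}. a) {x}"
        using a B_carrier[of x a] x by auto
      fix c assume c: "c \<in> PiE {x} B \<and> a = finsum (A\<lparr>carrier := B x\<rparr>) c {x}"
      then have "c x \<in> B x" by auto
      then have "a = c x" using c B_carrier[of x "c x"] x by simp
      then show "c = (\<lambda>y\<in>{x}. a)"
        using c by (auto intro!: PiE_ext[of c "{x}" B])
    qed
    then show "internal_direct_sum (A\<lparr>carrier := B x\<rparr>) (objects (isotropy G x)) B"
      using x self by (simp add: internal_direct_sum_def)
  qed
qed

corollary (in unital_partial_action) frobenius_isotropy:
  assumes x: "x \<in> objects G"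
  shows "frobenius_extension (with_one (A\<lparr>carrier := B x\<rparr>))
    (skew_ring (isotropy G x) (A\<lparr>carrier := B x\<rparr>) B \<beta>) (delta (isotropy G x) (A\<lparr>carrier := B x\<rparr>) x)"
proof (rule frobenius_extension_cong)
  interpret X: unital_partial_action "A\<lparr>carrier := B x\<rparr>" "isotropy G x" B \<beta>
    by (rule restriction[OF x])
  show "frobenius_extension (with_one (A\<lparr>carrier := B x\<rparr>))
      (skew_ring (isotropy G x) (A\<lparr>carrier := B x\<rparr>) B \<beta>)
      (skew_embedding (isotropy G x) (A\<lparr>carrier := B x\<rparr>) B)"
    by (rule X.frobenius_skew_ring)
  fix r assume "r \<in> carrier (with_one (A\<lparr>carrier := B x\<rparr>))"
  then have "r \<in> B x" by (simp add: with_one_def)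
  then have "r \<otimes>\<^bsub>A\<lparr>carrier := B x\<rparr>\<^esub> unit_at (A\<lparr>carrier := B x\<rparr>) B x = r"
    using X.times_idem[of x r] x by (simp add: arrows_def)
  then show "skew_embedding (isotropy G x) (A\<lparr>carrier := B x\<rparr>) B r
      = delta (isotropy G x) (A\<lparr>carrier := B x\<rparr>) x r"
    using x by (auto simp: skew_embedding_def delta_def intro!: restrict_ext)
qed


section \<open>Lifted partial actions\<close>

lemma in_ran_restrict_iff: "b \<in> ran (u |` X) \<longleftrightarrow> (\<exists>a\<in>X. u a = Some b)"
  by (auto simp: ran_def restrict_map_def)

lemma partial_inverse_eq_Some:
  assumes "\<And>a a' b. \<lbrakk>u a = Some b; u a' = Some b\<rbrakk> \<Longrightarrow> a = a'"
  shows "partial_inverse u b = Some a \<longleftrightarrow> u a = Some b"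
proof
  assume u: "u a = Some b"
  then have "(THE a. u a = Some b) = a" using assms by blast
  then show "partial_inverse u b = Some a" using u by (auto simp: partial_inverse_def ran_def)
next
  assume "partial_inverse u b = Some a"
  then have "b \<in> ran u" and a: "a = (THE a. u a = Some b)"
    by (auto simp: partial_inverse_def split: if_splits)
  then obtain a' where "u a' = Some b" by (auto simp: ran_def)
  moreover from this have "(THE a. u a = Some b) = a'" using assms by blast
  ultimately show "u a = Some b" using a by simp
qed

text \<open>Phrased with \<open>u a = Some b\<close> so that composites of partial bijections can be
  handled as chains of such equations. Products and sums must be known to lie in \<open>P\<close>,
  since \<open>rng_iso\<close> does not assert that \<open>P\<close> is closed.\<close>

lemma rng_isoD:
  assumes u: "rng_iso R P Q u"
  shows "u a = Some b \<Longrightarrow> a \<in> P" "u a = Some b \<Longrightarrow> b \<in> Q"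
    "a \<in> P \<Longrightarrow> \<exists>b. u a = Some b" "b \<in> Q \<Longrightarrow> \<exists>a. u a = Some b"
    "\<lbrakk>u a = Some b; u a' = Some b\<rbrakk> \<Longrightarrow> a = a'"
    "\<lbrakk>u a = Some b; u a' = Some b'; a \<otimes>\<^bsub>R\<^esub> a' \<in> P\<rbrakk> \<Longrightarrow> u (a \<otimes>\<^bsub>R\<^esub> a') = Some (b \<otimes>\<^bsub>R\<^esub> b')"
    "\<lbrakk>u a = Some b; u a' = Some b'; a \<oplus>\<^bsub>R\<^esub> a' \<in> P\<rbrakk> \<Longrightarrow> u (a \<oplus>\<^bsub>R\<^esub> a') = Some (b \<oplus>\<^bsub>R\<^esub> b')"
proof -
  have dom: "a \<in> P \<longleftrightarrow> (\<exists>b. u a = Some b)" for a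
    using u by (auto simp: rng_iso_iff)
  have bij: "bij_betw (\<lambda>a. the (u a)) P Q"
    using u by (simp add: rng_iso_iff)
  show 1: "u a = Some b \<Longrightarrow> a \<in> P" and "a \<in> P \<Longrightarrow> \<exists>b. u a = Some b" for a b
    using dom by auto
  show "u a = Some b \<Longrightarrow> b \<in> Q"
    using bij_betwE[OF bij] 1 by fastforce
  show "\<exists>a. u a = Some b" if b: "b \<in> Q"
  proof -
    from b have "b \<in> (\<lambda>a. the (u a)) ` P" using bij by (simp add: bij_betw_def)
    then show ?thesis using dom by auto
  qed
  show "\<lbrakk>u a = Some b; u a' = Some b\<rbrakk> \<Longrightarrow> a = a'"
    using bij 1 by (auto simp: bij_betw_def inj_on_def)
  assume a: "u a = Some b" "u a' = Some b'"
  have hom: "the (u (a \<otimes>\<^bsub>R\<^esub> a')) = b \<otimes>\<^bsub>R\<^esub> b'" "the (u (a \<oplus>\<^bsub>R\<^esub> a')) = b \<oplus>\<^bsub>R\<^esub> b'"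
    using u 1[OF a(1)] 1[OF a(2)] a by (simp_all add: rng_iso_iff)
  show "u (a \<otimes>\<^bsub>R\<^esub> a') = Some (b \<otimes>\<^bsub>R\<^esub> b')" if "a \<otimes>\<^bsub>R\<^esub> a' \<in> P"
    using hom(1) that dom by auto
  show "u (a \<oplus>\<^bsub>R\<^esub> a') = Some (b \<oplus>\<^bsub>R\<^esub> b')" if "a \<oplus>\<^bsub>R\<^esub> a' \<in> P"
    using hom(2) that dom by auto
qed

lemma rng_isoI:
  assumes "\<And>a a' b. \<lbrakk>u a = Some b; u a' = Some b\<rbrakk> \<Longrightarrow> a = a'"
    and "\<And>a b a' b'. \<lbrakk>u a = Some b; u a' = Some b'\<rbrakk> \<Longrightarrow> u (a \<otimes>\<^bsub>R\<^esub> a') = Some (b \<otimes>\<^bsub>R\<^esub> b')"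
    and "\<And>a b a' b'. \<lbrakk>u a = Some b; u a' = Some b'\<rbrakk> \<Longrightarrow> u (a \<oplus>\<^bsub>R\<^esub> a') = Some (b \<oplus>\<^bsub>R\<^esub> b')"
  shows "rng_iso R (dom u) (ran u) u"
proof -
  have "bij_betw (\<lambda>a. the (u a)) (dom u) (ran u)"
    unfolding bij_betw_def
  proof
    show "inj_on (\<lambda>a. the (u a)) (dom u)"
      using assms(1) by (auto intro!: inj_onI)
    show "(\<lambda>a. the (u a)) ` dom u = ran u"
      by (force simp: ran_def image_iff)
  qed
  then show ?thesis
    using assms(2,3) by (auto simp: rng_iso_iff)
qed

text \<open>The element \<open>b\<close> lies in the domain of the map at the inverse arrow, and the
  composite of the two maps is contained in an identity map, so the value can only be
  \<open>a\<close>.\<close>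

lemma (in groupoid) partial_action_inverse:
  assumes "partial_action G A D \<alpha>" "g \<in> carrier G" "\<alpha> g a = Some b"
  shows "\<alpha> (ginv G g) b = Some a"
proof -
  have iso: "rng_iso A (D (ginv G g)) (D g) (\<alpha> g)" "rng_iso A (D g) (D (ginv G g)) (\<alpha> (ginv G g))"
    using assms(1,2) ginv_closed[OF assms(2)] ginv_ginv[OF assms(2)]
    unfolding partial_action_def by metis+
  obtain c where c: "\<alpha> (ginv G g) b = Some c"
    using rng_isoD(3)[OF iso(2)] rng_isoD(2)[OF iso(1) assms(3)] by blast
  have "(\<alpha> (ginv G g) \<circ>\<^sub>m \<alpha> g) \<subseteq>\<^sub>m \<alpha> (src G g)"
    using assms(1,2) ginv_closed[OF assms(2)] ginv_cmp[OF assms(2)] src_ginv[OF assms(2)]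
    unfolding partial_action_def by metis
  moreover have "(\<alpha> (ginv G g) \<circ>\<^sub>m \<alpha> g) a = Some c"
    using assms(3) c by simp
  ultimately have "\<alpha> (src G g) a = Some c"
    by (auto simp: map_le_def dom_def)
  moreover have "\<alpha> (src G g) = Some |` D (src G g)"
    using assms(1,2) by (simp add: partial_action_def)
  ultimately show ?thesis
    using c by (simp add: restrict_map_def split: if_splits)
qed

locale global_lift = rng A + groupoid G + lifting_datum G x \<tau> A I \<gamma>
  for A :: "('a, 'n) ring_scheme" and G :: "('g, 'm) arrow_structure_scheme"
    and x \<tau> I \<gamma> +
  fixes B :: "'g \<Rightarrow> 'a set" and \<beta> :: "'g \<Rightarrow> 'a \<rightharpoonup> 'a"
  assumes x_object: "x \<in> objects G"
    and transversal: "transversal G x \<tau>"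
    and \<beta>_def: "\<beta> = lifted_map G \<tau> I \<gamma>"
    and B_def: "B = (\<lambda>g. ran (\<beta> g))"
    and global: "global_along G x \<tau> B"
    and gamma_unital: "gamma_unital G x A I \<gamma>"
begin

section \<open>Loops at the base point and the datum over them\<close>

abbreviation comp (infixl "\<star>" 75) where "g \<star> h \<equiv> g \<odot>\<^bsub>G\<^esub> h"
abbreviation lp where "lp \<equiv> loop_of G \<tau>"

lemma
  assumes "y \<in> objects G"
  shows \<tau>_carrier [simp]: "\<tau> y \<in> carrier G"
    and src_\<tau> [simp]: "src G (\<tau> y) = x"
    and tgt_\<tau> [simp]: "tgt G (\<tau> y) = y"
  using transversal assms by (auto simp: transversal_def arrows_def)

lemma \<tau>_x [simp]: "\<tau> x = x"
  using transversal by (simp add: transversal_def)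

lemma
  assumes "g \<in> carrier G"
  shows lp_carrier [simp]: "lp g \<in> carrier G"
    and src_lp [simp]: "src G (lp g) = x"
    and tgt_lp [simp]: "tgt G (lp g) = x"
  using assms by (simp_all add: loop_of_def)

lemma lp_arrows [simp]: "g \<in> carrier G \<Longrightarrow> lp g \<in> arrows G x x"
  by (simp add: arrows_def)

text \<open>The transversal arrow at the middle object cancels against its inverse:
  \<open>lp\<close> is a functor from the groupoid to its isotropy group.\<close>

lemma lp_cmp:
  assumes "g \<in> carrier G" "h \<in> carrier G" "src G g = tgt G h"
  shows "lp (g \<star> h) = lp g \<star> lp h"
  using assms by (simp add: loop_of_def cmp_assoc)

lemma lp_object [simp]: "y \<in> objects G \<Longrightarrow> lp y = x"
  by (simp add: loop_of_def cmp_assoc)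

lemma lp_\<tau> [simp]: "y \<in> objects G \<Longrightarrow> lp (\<tau> y) = x"
  using x_object by (simp add: loop_of_def)

lemma lp_ginv: "g \<in> carrier G \<Longrightarrow> lp (ginv G g) = ginv G (lp g)"
  using lp_cmp[of "ginv G g" g] lp_cmp[of g "ginv G g"]
  by (intro ginv_eqI[symmetric]) (auto simp: is_inverse_def)

lemma loop_action: "partial_action (isotropy G x) (A\<lparr>carrier := I x\<rparr>) I \<gamma>"
  using action by (simp add: group_partial_action_def)

lemma loop_iso: "h \<in> arrows G x x \<Longrightarrow> rng_iso A (I (ginv G h)) (I h) (\<gamma> h)"
  using loop_action by (auto simp: partial_action_def)

lemma loop_ideal: "h \<in> arrows G x x \<Longrightarrow> rng_ideal (I h) (A\<lparr>carrier := I x\<rparr>)"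
  using loop_action by (auto simp: partial_action_def arrows_def)

lemma loop_subset: "h \<in> arrows G x x \<Longrightarrow> I h \<subseteq> I x"
  using rng.rng_idealD(1)[OF rng_rng_ideal[OF ideals[OF x_object]] loop_ideal] by simp

lemma loop_closed:
  assumes "h \<in> arrows G x x" "a \<in> I h" "b \<in> I h"
  shows "a \<oplus>\<^bsub>A\<^esub> b \<in> I h" "a \<otimes>\<^bsub>A\<^esub> b \<in> I h"
  using rng.rng_idealD(3,5)[OF rng_rng_ideal[OF ideals[OF x_object]] loop_ideal[OF assms(1)]]
    assms loop_subset[OF assms(1)] by auto

lemma loop_inverse:
  assumes "h \<in> arrows G x x" "\<gamma> h a = Some b"
  shows "\<gamma> (ginv G h) b = Some a"
proof -
  interpret X: groupoid "isotropy G x" by (rule groupoid_isotropy)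
  show ?thesis
    using X.partial_action_inverse[OF loop_action _ assms(2)] assms(1) by simp
qed

lemma loop_comp:
  assumes "g \<in> arrows G x x" "h \<in> arrows G x x" "\<gamma> h a = Some b" "\<gamma> g b = Some c"
  shows "\<gamma> (g \<star> h) a = Some c"
proof -
  have "(\<gamma> g \<circ>\<^sub>m \<gamma> h) \<subseteq>\<^sub>m \<gamma> (g \<star> h)"
    using loop_action assms(1,2) by (auto simp: partial_action_def arrows_def)
  moreover have "(\<gamma> g \<circ>\<^sub>m \<gamma> h) a = Some c" using assms by simp
  ultimately show ?thesis by (auto simp: map_le_def dom_def)
qed

lemma \<gamma>_x_eq_Some: "\<gamma> x a = Some b \<longleftrightarrow> a \<in> I x \<and> a = b"
  by (auto simp: identity restrict_map_def)

lemma \<tau>_inverse: "y \<in> objects G \<Longrightarrow> partial_inverse (\<gamma> (\<tau> y)) b = Some a \<longleftrightarrow> \<gamma> (\<tau> y) a = Some b"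
  using rng_isoD(5)[OF isos] by (intro partial_inverse_eq_Some)

section \<open>The lifted maps as conjugates of loop maps\<close>

lemma \<beta>_eq_Some_not_object:
  assumes "g \<in> carrier G" "g \<notin> objects G"
  shows "\<beta> g a = Some c \<longleftrightarrow> (\<exists>a' c'. \<gamma> (\<tau> (src G g)) a' = Some a \<and> \<gamma> (lp g) a' = Some c' \<and>
    \<gamma> (\<tau> (tgt G g)) c' = Some c)"
  using assms by (auto simp: \<beta>_def lifted_map_def map_comp_Some_iff \<tau>_inverse)

lemma B_object: "y \<in> objects G \<Longrightarrow> B y = I y"
  by (auto simp: B_def \<beta>_def lifted_map_def ran_def restrict_map_def)

text \<open>Converts globality from ranges of lifted maps into the ideals of the datum. For
  \<open>y\<close> other than \<open>x\<close>, the loop of \<open>\<tau> y\<close> is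
  \<open>x\<close>, whose map is an identity, so the lift at \<open>\<tau> y\<close> is
  \<open>\<gamma> (\<tau> y)\<close> and the lift at its inverse is the inverse bijection. The case
  \<open>y = x\<close> is separate because there the transversal arrow is an object.\<close>

lemma I_\<tau>:
  assumes y: "y \<in> objects G" shows "I (\<tau> y) = I y" "I (ginv G (\<tau> y)) = I x"
proof -
  have sub: "I (ginv G (\<tau> y)) \<subseteq> I x"
    using rng.rng_idealD(1)[OF rng_rng_ideal[OF ideals[OF x_object]] ideal_tau_inv[OF y]] by simp
  note D = rng_isoD[OF isos[OF y]]
  have "I (\<tau> y) = I y \<and> I (ginv G (\<tau> y)) = I x"
  proof (cases "y = x")
    case True
    then show ?thesis using x_object by simp
  next
    case False
    then have o: "\<tau> y \<notin> objects G" "ginv G (\<tau> y) \<notin> objects G"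
      using y src_object tgt_object by (metis \<tau>_carrier src_\<tau> tgt_\<tau>, metis \<tau>_carrier ginv_ginv ginv_object src_\<tau> tgt_\<tau>)
    have "\<beta> (\<tau> y) a = Some c \<longleftrightarrow> \<gamma> (\<tau> y) a = Some c" for a c
      using \<beta>_eq_Some_not_object[OF _ o(1)] y x_object sub D(1) by (auto simp: \<gamma>_x_eq_Some)
    then have "B (\<tau> y) = I (\<tau> y)"
      using D(2,4) by (auto simp: B_def ran_def)
    moreover have "lp (ginv G (\<tau> y)) = x"
      using y x_object by (simp add: lp_ginv)
    then have "\<beta> (ginv G (\<tau> y)) c = Some a \<longleftrightarrow> \<gamma> (\<tau> y) a = Some c" for a c
      using \<beta>_eq_Some_not_object[OF _ o(2)] y x_object sub D(1) by (auto simp: \<gamma>_x_eq_Some)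
    then have "B (ginv G (\<tau> y)) = I (ginv G (\<tau> y))"
      using D(1,3) by (auto simp: B_def ran_def)
    ultimately show ?thesis
      using global y x_object by (simp add: global_along_def B_object)
  qed
  then show "I (\<tau> y) = I y" "I (ginv G (\<tau> y)) = I x" by auto
qed

lemma \<tau>_iso: "y \<in> objects G \<Longrightarrow> rng_iso A (I x) (I y) (\<gamma> (\<tau> y))"
  using isos[of y] by (simp add: I_\<tau>)

text \<open>Removes the case distinction of \<open>lifted_map\<close>: at an object the composite is
  the identity on the image of its transversal map, which by globality is the whole ideal
  \<open>I g\<close>.\<close>

lemma \<beta>_eq_Some:
  assumes g: "g \<in> carrier G"
  shows "\<beta> g a = Some c \<longleftrightarrow> (\<exists>a' c'. \<gamma> (\<tau> (src G g)) a' = Some a \<and> \<gamma> (lp g) a' = Some c' \<and>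
    \<gamma> (\<tau> (tgt G g)) c' = Some c)"
proof (cases "g \<in> objects G")
  case True
  have "\<beta> g a = Some c \<longleftrightarrow> a \<in> I g \<and> a = c"
    using True by (auto simp: \<beta>_def lifted_map_def restrict_map_def)
  moreover have "a \<in> I g \<longleftrightarrow> (\<exists>a'. a' \<in> I x \<and> \<gamma> (\<tau> g) a' = Some a)"
    using rng_isoD(1,2,4)[OF \<tau>_iso[OF True]] by blast
  ultimately show ?thesis
    using True by (auto simp: \<gamma>_x_eq_Some)
qed (simp add: \<beta>_eq_Some_not_object g)

text \<open>By globality the transversal map at the source is defined on all of \<open>I x\<close>,
  so the first leg of the composite does not shrink the range.\<close>

lemma in_B_iff:
  assumes g: "g \<in> carrier G"
  shows "c \<in> B g \<longleftrightarrow> (\<exists>c'\<in>I (lp g). \<gamma> (\<tau> (tgt G g)) c' = Some c)"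
proof
  assume "c \<in> B g"
  then obtain a a' c' where "\<gamma> (lp g) a' = Some c'" "\<gamma> (\<tau> (tgt G g)) c' = Some c"
    using \<beta>_eq_Some[OF g] by (auto simp: B_def ran_def)
  then show "\<exists>c'\<in>I (lp g). \<gamma> (\<tau> (tgt G g)) c' = Some c"
    using rng_isoD(2)[OF loop_iso[OF lp_arrows[OF g]]] by blast
next
  assume "\<exists>c'\<in>I (lp g). \<gamma> (\<tau> (tgt G g)) c' = Some c"
  then obtain c' a' where c: "\<gamma> (\<tau> (tgt G g)) c' = Some c" "\<gamma> (lp g) a' = Some c'"
    using rng_isoD(4)[OF loop_iso[OF lp_arrows[OF g]]] by blast
  then have "a' \<in> I x"
    using rng_isoD(1)[OF loop_iso[OF lp_arrows[OF g]]] loop_subset[of "ginv G (lp g)"] g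
    by (auto simp: arrows_def)
  then obtain a where "\<gamma> (\<tau> (src G g)) a' = Some a"
    using rng_isoD(3)[OF \<tau>_iso[of "src G g"]] g by auto
  then show "c \<in> B g"
    using c \<beta>_eq_Some[OF g] by (auto simp: B_def ran_def)
qed

text \<open>This is the content of the condition \<open>ideal_range\<close>: under globality its
  intersections with \<open>I x\<close> have no effect, and the remaining set is
  \<open>B g\<close>.\<close>

lemma B_ideal_tgt:
  assumes g: "g \<in> carrier G" shows "rng_ideal (B g) (A\<lparr>carrier := B (tgt G g)\<rparr>)"
proof -
  have iso: "rng_iso A (I (ginv G (lp g))) (I (lp g)) (\<gamma> (lp g))"
    by (rule loop_iso[OF lp_arrows[OF g]])
  have sub: "I (lp g) \<subseteq> I x" "I (ginv G (lp g)) \<subseteq> I x"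
    using loop_subset[of "lp g"] loop_subset[of "ginv G (lp g)"] g by (auto simp: arrows_def)
  have "ran (\<gamma> (lp g) |` (I x \<inter> I (ginv G (lp g)))) = I (lp g)"
    unfolding set_eq_iff in_ran_restrict_iff using rng_isoD(1,2,4)[OF iso] sub(2) by blast
  then have "ran (\<gamma> (\<tau> (tgt G g)) |` (I (ginv G (\<tau> (tgt G g))) \<inter>
      ran (\<gamma> (lp g) |` (I (ginv G (\<tau> (src G g))) \<inter> I (ginv G (lp g)))))) = B g"
    unfolding set_eq_iff using g sub(1) by (auto simp: I_\<tau> in_B_iff in_ran_restrict_iff)
  then show ?thesis
    using ideal_range[OF g] g by (simp add: B_object)
qed

lemma \<beta>_inverse:
  assumes g: "g \<in> carrier G" and "\<beta> g a = Some c" shows "\<beta> (ginv G g) c = Some a"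
proof -
  obtain a' c' where "\<gamma> (\<tau> (src G g)) a' = Some a" "\<gamma> (lp g) a' = Some c'" "\<gamma> (\<tau> (tgt G g)) c' = Some c"
    using assms \<beta>_eq_Some by blast
  moreover from this have "\<gamma> (lp (ginv G g)) c' = Some a'"
    using loop_inverse[of "lp g"] g by (simp add: lp_ginv)
  ultimately show ?thesis
    using g by (auto simp: \<beta>_eq_Some)
qed

lemma \<beta>_hom:
  assumes g: "g \<in> carrier G" and "\<beta> g a = Some c" "\<beta> g b = Some d"
  shows "\<beta> g (a \<otimes>\<^bsub>A\<^esub> b) = Some (c \<otimes>\<^bsub>A\<^esub> d)" "\<beta> g (a \<oplus>\<^bsub>A\<^esub> b) = Some (c \<oplus>\<^bsub>A\<^esub> d)"
proof -
  have L: "lp g \<in> arrows G x x" "ginv G (lp g) \<in> arrows G x x" "x \<in> arrows G x x"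
    using g x_object by (auto simp: arrows_def)
  note s = rng_isoD[OF \<tau>_iso[of "src G g"]] and t = rng_isoD[OF \<tau>_iso[of "tgt G g"]]
    and l = rng_isoD[OF loop_iso[OF L(1)]]
  obtain a' c' where a: "\<gamma> (\<tau> (src G g)) a' = Some a" "\<gamma> (lp g) a' = Some c'" "\<gamma> (\<tau> (tgt G g)) c' = Some c"
    using assms \<beta>_eq_Some by blast
  obtain b' d' where b: "\<gamma> (\<tau> (src G g)) b' = Some b" "\<gamma> (lp g) b' = Some d'" "\<gamma> (\<tau> (tgt G g)) d' = Some d"
    using assms \<beta>_eq_Some by blast
  \<comment> \<open>The homomorphism clauses of \<open>rng_isoD\<close> require sums and products to
    stay in the domains. Those domains are \<open>I x\<close> for both transversal maps and
    \<open>I (ginv G (lp g))\<close> for the loop map.\<close>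
  have sc: "u \<oplus>\<^bsub>A\<^esub> v \<in> I x" "u \<otimes>\<^bsub>A\<^esub> v \<in> I x" if "u \<in> I x" "v \<in> I x" for u v
    using loop_closed[OF L(3)] that by auto
  have lc: "u \<oplus>\<^bsub>A\<^esub> v \<in> I (ginv G (lp g))" "u \<otimes>\<^bsub>A\<^esub> v \<in> I (ginv G (lp g))"
    if "u \<in> I (ginv G (lp g))" "v \<in> I (ginv G (lp g))" for u v
    using loop_closed[OF L(2)] that by auto
  have "\<gamma> (\<tau> (src G g)) (a' \<otimes>\<^bsub>A\<^esub> b') = Some (a \<otimes>\<^bsub>A\<^esub> b)" "\<gamma> (lp g) (a' \<otimes>\<^bsub>A\<^esub> b') = Some (c' \<otimes>\<^bsub>A\<^esub> d')"
    "\<gamma> (\<tau> (tgt G g)) (c' \<otimes>\<^bsub>A\<^esub> d') = Some (c \<otimes>\<^bsub>A\<^esub> d)"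
    using a b g by (auto intro!: s(6) t(6) l(6) sc lc intro: s(1) t(1) l(1))
  then show "\<beta> g (a \<otimes>\<^bsub>A\<^esub> b) = Some (c \<otimes>\<^bsub>A\<^esub> d)"
    using g \<beta>_eq_Some by blast
  have "\<gamma> (\<tau> (src G g)) (a' \<oplus>\<^bsub>A\<^esub> b') = Some (a \<oplus>\<^bsub>A\<^esub> b)" "\<gamma> (lp g) (a' \<oplus>\<^bsub>A\<^esub> b') = Some (c' \<oplus>\<^bsub>A\<^esub> d')"
    "\<gamma> (\<tau> (tgt G g)) (c' \<oplus>\<^bsub>A\<^esub> d') = Some (c \<oplus>\<^bsub>A\<^esub> d)"
    using a b g by (auto intro!: s(7) t(7) l(7) sc lc intro: s(1) t(1) l(1))
  then show "\<beta> g (a \<oplus>\<^bsub>A\<^esub> b) = Some (c \<oplus>\<^bsub>A\<^esub> d)"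
    using g \<beta>_eq_Some by blast
qed

lemma \<beta>_iso:
  assumes g: "g \<in> carrier G" shows "rng_iso A (B (ginv G g)) (B g) (\<beta> g)"
proof -
  have "\<beta> g a = Some c \<longleftrightarrow> \<beta> (ginv G g) c = Some a" for a c
    using \<beta>_inverse[OF g] \<beta>_inverse[OF ginv_closed[OF g], unfolded ginv_ginv[OF g]] by blast
  then have "dom (\<beta> g) = B (ginv G g)"
    by (auto simp: B_def ran_def dom_def)
  moreover have "rng_iso A (dom (\<beta> g)) (ran (\<beta> g)) (\<beta> g)"
  proof (rule rng_isoI)
    show "a = a'" if "\<beta> g a = Some b" "\<beta> g a' = Some b" for a a' b
      using \<beta>_inverse[OF g that(1)] \<beta>_inverse[OF g that(2)] by simp
  qed (simp_all add: \<beta>_hom[OF g])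
  ultimately show ?thesis by (simp add: B_def)
qed

lemma \<beta>_comp:
  assumes "g \<in> carrier G" "h \<in> carrier G" "src G g = tgt G h" "\<beta> h a = Some b" "\<beta> g b = Some c"
  shows "\<beta> (g \<star> h) a = Some c"
proof -
  obtain a' b' where h: "\<gamma> (\<tau> (src G h)) a' = Some a" "\<gamma> (lp h) a' = Some b'" "\<gamma> (\<tau> (tgt G h)) b' = Some b"
    using assms \<beta>_eq_Some[of h] by blast
  obtain b'' c' where g: "\<gamma> (\<tau> (tgt G h)) b'' = Some b" "\<gamma> (lp g) b'' = Some c'" "\<gamma> (\<tau> (tgt G g)) c' = Some c"
    using assms \<beta>_eq_Some[of g] by auto
  \<comment> \<open>The last leg of the lift at \<open>h\<close> and the first leg of the lift at
    \<open>g\<close> use the same transversal map; its injectivity cancels them and leaves a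
    composite of loop maps.\<close>
  have "b'' = b'"
    using rng_isoD(5)[OF \<tau>_iso[of "tgt G h"] g(1) h(3)] assms by simp
  then have "\<gamma> (lp (g \<star> h)) a' = Some c'"
    using loop_comp[of "lp g" "lp h" a' b' c'] g h assms by (simp add: lp_cmp)
  then show ?thesis
    using assms h g by (auto simp: \<beta>_eq_Some)
qed

lemma lifted_partial_action: "partial_action G A B \<beta>"
  unfolding partial_action_def
proof (intro conjI ballI impI)
  fix g assume g: "g \<in> carrier G"
  show "rng_ideal (B (tgt G g)) A" using g by (simp add: B_object ideals)
  show "rng_ideal (B g) (A\<lparr>carrier := B (tgt G g)\<rparr>)" by (rule B_ideal_tgt[OF g])
  show "rng_iso A (B (ginv G g)) (B g) (\<beta> g)" by (rule \<beta>_iso[OF g])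
next
  fix y assume "y \<in> objects G"
  then show "\<beta> y = Some |` B y"
    by (simp add: B_object) (simp add: \<beta>_def lifted_map_def)
next
  fix g h assume gh: "g \<in> carrier G" "h \<in> carrier G" "src G g = tgt G h"
  then show "(\<beta> g \<circ>\<^sub>m \<beta> h) \<subseteq>\<^sub>m \<beta> (g \<star> h)"
    using \<beta>_comp[OF gh] by (force simp: map_le_def map_comp_Some_iff)
qed

text \<open>The transversal map at the target carries \<open>I (lp g)\<close> onto
  \<open>B g\<close>, and with it the identity supplied by \<open>gamma_unital\<close>.\<close>

lemma B_unital:
  assumes g: "g \<in> carrier G" shows "unital_rng (A\<lparr>carrier := B g\<rparr>)"
proof -
  have lg: "lp g \<in> arrows G x x" by (rule lp_arrows[OF g])
  obtain e where e: "is_identity (A\<lparr>carrier := I (lp g)\<rparr>) e"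
    using gamma_unital lg by (auto simp: gamma_unital_def unital_group_partial_action_def)
  have eI: "e \<in> I (lp g)" "e \<in> I x"
    using e loop_subset[OF lg] by (auto simp: is_identity_def)
  note t = rng_isoD[OF \<tau>_iso[OF tgt_in_objects[OF g]]]
  obtain f where f: "\<gamma> (\<tau> (tgt G g)) e = Some f"
    using t(3)[OF eI(2)] by blast
  have "f \<otimes>\<^bsub>A\<^esub> c = c \<and> c \<otimes>\<^bsub>A\<^esub> f = c" if "c \<in> B g" for c
  proof -
    from that obtain c' where c': "c' \<in> I (lp g)" "\<gamma> (\<tau> (tgt G g)) c' = Some c"
      unfolding in_B_iff[OF g] by (elim bexE)
    then have "e \<otimes>\<^bsub>A\<^esub> c' = c'" "c' \<otimes>\<^bsub>A\<^esub> e = c'" "c' \<in> I x"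
      using e loop_subset[OF lg] by (auto simp: is_identity_def)
    then show ?thesis
      using t(6)[OF f c'(2)] t(6)[OF c'(2) f] c'(2) by simp
  qed
  moreover have "f \<in> B g"
    unfolding in_B_iff[OF g] using f eI(1) by (intro bexI)
  ultimately have "is_identity (A\<lparr>carrier := B g\<rparr>) f"
    by (simp add: is_identity_def)
  then show ?thesis by (auto simp: unital_rng_def)
qed

end

theorem theorem8p4:
  fixes G :: "('g, 'm) arrow_structure_scheme" and x :: 'g and \<tau> :: "'g \<Rightarrow> 'g"
    and A :: "('a, 'n) ring_scheme"
    and I :: "'g \<Rightarrow> 'a set" and \<gamma> :: "'g \<Rightarrow> 'a \<rightharpoonup> 'a"
    and B :: "'g \<Rightarrow> 'a set" and \<beta> :: "'g \<Rightarrow> 'a \<rightharpoonup> 'a"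
  assumes "groupoid G" and "finite (carrier G)" and "connected_groupoid G"
    and "x \<in> objects G" and "transversal G x \<tau>"
    and "rng A"
    and "lifting_datum G x \<tau> A I \<gamma>"
    and "\<beta> = lifted_map G \<tau> I \<gamma>" and "B = (\<lambda>g. ran (\<beta> g))"
    and "global_along G x \<tau> B"
    and "gamma_unital G x A I \<gamma>"
    and "internal_direct_sum A (objects G) I"
    and "internal_direct_sum A (objects G) B"
  shows "frobenius_extension (with_one A) (skew_ring G A B \<beta>) (skew_embedding G A B)
       \<and> frobenius_extension (with_one (A\<lparr>carrier := B x\<rparr>))
           (skew_ring (isotropy G x) (A\<lparr>carrier := B x\<rparr>) B \<beta>)
           (delta (isotropy G x) (A\<lparr>carrier := B x\<rparr>) x)"
proof -
  interpret global_lift A G x \<tau> I \<gamma> B \<beta>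
    using assms by (intro global_lift.intro global_lift_axioms.intro)
  interpret P: unital_partial_action A G B \<beta>
    by unfold_locales (use assms lifted_partial_action B_unital in auto)
  show ?thesis
    using P.frobenius_skew_ring P.frobenius_isotropy[OF x_object] by blast
qed

end
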